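(* Let $(K,\mathcal K)$ be a measurable space and $(T_{\mathsf k})_{\mathsf k\in K}$ a family of firmly quasinonexpansive operators from $H$ to $H$ such that $\boldsymbol T\colon(K\times H,\mathcal K\otimes\mathcal B_H)\to(H,\mathcal B_H)\colon(\mathsf k,\mathsf x)\mapsto T_{\mathsf k}\mathsf x$ is measurable and, for every $\mathsf k\in K$, $\mathrm{Id}-T_{\mathsf k}$ is demiclosed at $0$. Let $k\colon(\Omega,\mathcal F,\mathbb P)\to(K,\mathcal K)$ be a random variable and suppose that $$Z=\{\mathsf z\in H:\mathsf z\in\operatorname{Fix}T_k\ \text{a.s.}\}\ne\varnothing.$$ Let $x_0\in L^2(\Omega,\mathcal F,\mathbb P;H)$, let $M\ge1$ be an integer, $\delta\in\,]0,1/M[$, and $\rho\in[2,+\infty[$. For every $n\in\mathbb N$, iterate as follows: - $\mathcal X_n=\sigma(x_0,\dots,x_n)$; - for $i=1,\dots,M$, $k_{i,n}$ is a copy of $k$ and is independent of $\mathcal X_n$, and $p_{i,n}=T_{k_{i,n}}x_n$; - $(\beta_{i,n})_{1\le i\le M}$ are $[0,1]$-valued random variables such that $\sum_{i=1}^M\beta_{i,n}=1$ a.s. and, for every $i\in\{1,\dots,M\}$, $\beta_{i,n}\ge\delta\,1_{[\|p_{i,n}-x_n\|=\max_{1\le j\le M}\|p_{j,n}-x_n\|]}$; - $p_n=\sum_{i=1}^M\beta_{i,n}p_{i,n}$; - $L_n=\dfrac{\sum_{i=1}^M\beta_{i,n}\|p_{i,n}-x_n\|^2+1_{[p_n=x_n]}}{\|p_n-x_n\|^2+1_{[p_n=x_n]}}$;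 - $a_n=x_n+L_n(p_n-x_n)$; - take $\lambda_n\in L^\infty(\Omega,\mathcal F,\mathbb P;\,]0,\rho])$ and set $x_{n+1}=x_n+\lambda_n(a_n-x_n)$. Suppose that there exists $\mu\in\,]0,1[$ such that $\inf_{n\in\mathbb N}\mathsf E(\lambda_n(2-\lambda_n))\ge\mu$ and that, for every $n\in\mathbb N$, $\lambda_n$ is independent of $\sigma(p_{1,n},\dots,p_{M,n},\beta_{1,n},\dots,\beta_{M,n},x_0,\dots,x_n)$. Then the following hold for some $x\in L^2(\Omega,\mathcal F,\mathbb P;Z)$: (i) $(x_n)_{n\in\mathbb N}$ converges weakly in $L^2(\Omega,\mathcal F,\mathbb P;H)$ and weakly a.s. to $x$. (ii) Suppose that there exists $S\in\mathcal F$ such that $S\subset\{\omega\in\Omega: T_{k(\omega)}-\mathrm{Id}\text{ is demiregular at every point in }\operatorname{Fix}T_{k(\omega)}\}$ and $\mathbb P(S)>0$. Then $(x_n)_{n\in\mathbb N}$ converges strongly in $L^1(\Omega,\mathcal F,\mathbb P;H)$ and strongly a.s. to $x$. (iii) Suppose that one of the following is satisfied: [A] There exists $\chi\in\,]0,1[$ such that $\mathsf E(\mathsf d_Z^2(x_{n+1})|\mathcal X_n)\le\chi\,\mathsf d_Z^2(x_n)$ a.s. for every $n\in\mathbb N$. [B] $\boldsymbol T$ is linearly regular in the sense that there exists $\nu\in[1,+\infty[$ such that $$(\forall\mathsf x\in H)\quad\mathsf d_Z^2(\mathsf x)\le\nu\,\mathsf E\|T_k\mathsf x-\mathsf x\|^2=\nu\int_\Omega\|T_{k(\omega)}\mathsf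 x-\mathsf x\|^2\,\mathbb P(d\omega),$$ in which case we set $\zeta=\inf_{j\in\mathbb N}\mathsf E\lambda_j^2$ and $\chi=1-\mu\delta\zeta/(\rho^2\nu)$. Then $(x_n)_{n\in\mathbb N}$ converges strongly in $L^2(\Omega,\mathcal F,\mathbb P;H)$ and strongly a.s. to $x$, and $$(\forall n\in\mathbb N)\quad\mathsf E\|x_n-x\|^2\le4\chi^n\,\mathsf E\,\mathsf d_Z^2(x_0).$$
   Context: $H$ is a separable real Hilbert space with norm $\|\cdot\|$, Borel $\sigma$-algebra $\mathcal B_H$ and identity operator $\mathrm{Id}$; $(\Omega,\mathcal F,\mathbb P)$ is a complete probability space with expectation $\mathsf E$; "a.s." means $\mathbb P$-almost surely. For $T\colon H\to H$, $\operatorname{Fix}T=\{\mathsf x\in H:T\mathsf x=\mathsf x\}$. $T$ is firmly quasinonexpansive if $\|T\mathsf x-\mathsf y\|^2+\|T\mathsf x-\mathsf x\|^2\le\|\mathsf x-\mathsf y\|^2$ for all $\mathsf x\in H$ and $\mathsf y\in\operatorname{Fix}T$. $\mathrm{Id}-T$ is demiclosed at $0$ if, whenever $\mathsf x_n\rightharpoonup\mathsf x$ (weakly) and $\mathsf x_n-T\mathsf x_n\to0$ (strongly), one has $T\mathsf x=\mathsf x$. An operator $A\colon H\to H$ is demiregular at $\mathsf x\in H$ if, for every sequence $(\mathsf x_n)$ in $H$ such that $\mathsf x_n\rightharpoonup\mathsf x$ and $A\mathsf x_n\to A\mathsf x$, we have $\mathsf x_n\to\mathsf x$ strongly. "$\mathsf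 z\in\operatorname{Fix}T_k$ a.s." means $\mathsf z\in\operatorname{Fix}T_{k(\omega)}$ for $\mathbb P$-almost every $\omega$. $\mathsf d_Z\colon\mathsf x\mapsto\inf_{\mathsf y\in Z}\|\mathsf y-\mathsf x\|$. A random variable $y$ with values in $(K,\mathcal K)$ is a copy of $x$ if $\mathbb P([x\in S])=\mathbb P([y\in S])$ for every $S\in\mathcal K$. $1_{[\cdot]}$ is the indicator function of an event. $L^p(\Omega,\mathcal F,\mathbb P;H)$ is the space of (classes of a.s. equal) $H$-valued random variables with $\mathsf E\|x\|^p<+\infty$, with norm $(\mathsf E\|x\|^p)^{1/p}$; $L^p(\Omega,\mathcal F,\mathbb P;S)$ is the subset of those with values in the Borel set $S\subset H$ a.s. For $S\subset\mathbb R$, $L^\infty(\Omega,\mathcal F,\mathbb P;S)$ is the set of essentially bounded real random variables with values in $S$ a.s. $\mathsf E(\cdot|\mathcal X)$ is conditional expectation and $\sigma(\cdot)$ the generated $\sigma$-algebra. Weak (strong) convergence a.s. means weak (strong) convergence in $H$ of $(x_n(\omega))_n$ for $\mathbb P$-almost every $\omega$. *)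

theory Defs
  imports "HOL-Probability.Probability"
begin

definition Fix :: "('a \<Rightarrow> 'a) \<Rightarrow> 'a set" where
  "Fix T = {x. T x = x}"

definition firmly_quasinonexpansive :: "('a::real_normed_vector \<Rightarrow> 'a) \<Rightarrow> bool" where
  "firmly_quasinonexpansive T \<longleftrightarrow>
     (\<forall>x. \<forall>y\<in>Fix T. (norm (T x - y))\<^sup>2 + (norm (T x - x))\<^sup>2 \<le> (norm (x - y))\<^sup>2)"

(* The weak topology of a Hilbert space is the one induced by the functionals
   inner _ u; by Riesz these are all the continuous linear functionals. *)
definition weakly_converges :: "(nat \<Rightarrow> 'a::real_inner) \<Rightarrow> 'a \<Rightarrow> bool" where
  "weakly_converges X x \<longleftrightarrow> (\<forall>u. (\<lambda>n. inner (X n) u) \<longlonglongrightarrow> inner x u)"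

definition id_minus_demiclosed_at_0 :: "('a::real_inner \<Rightarrow> 'a) \<Rightarrow> bool" where
  "id_minus_demiclosed_at_0 T \<longleftrightarrow>
     (\<forall>X x. weakly_converges X x \<and> (\<lambda>n. X n - T (X n)) \<longlonglongrightarrow> 0 \<longrightarrow> T x = x)"

definition demiregular_at :: "('a::real_inner \<Rightarrow> 'a) \<Rightarrow> 'a \<Rightarrow> bool" where
  "demiregular_at A x \<longleftrightarrow>
     (\<forall>X. weakly_converges X x \<and> (\<lambda>n. A (X n)) \<longlonglongrightarrow> A x \<longrightarrow> X \<longlonglongrightarrow> x)"

definition is_copy :: "'w measure \<Rightarrow> 'k measure \<Rightarrow> ('w \<Rightarrow> 'k) \<Rightarrow> ('w \<Rightarrow> 'k) \<Rightarrow> bool" where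
  "is_copy P K x y \<longleftrightarrow> x \<in> measurable P K \<and> y \<in> measurable P K \<and>
     (\<forall>S\<in>sets K. measure P (x -` S \<inter> space P) = measure P (y -` S \<inter> space P))"

(* Elements of Lebesgue spaces are represented by functions; a.s. equal functions
   are not identified, so every equation between such elements is stated a.s. *)
definition Lp :: "nat \<Rightarrow> 'w measure \<Rightarrow> 'a::real_normed_vector set \<Rightarrow> ('w \<Rightarrow> 'a) set" where
  "Lp p P S = {f \<in> borel_measurable P.
     integrable P (\<lambda>\<omega>. norm (f \<omega>) ^ p) \<and> (AE \<omega> in P. f \<omega> \<in> S)}"

definition Linf :: "'w measure \<Rightarrow> real set \<Rightarrow> ('w \<Rightarrow> real) set" where
  "Linf P S = {f \<in> borel_measurable P.
     (\<exists>C. AE \<omega> in P. \<bar>f \<omega>\<bar> \<le> C) \<and> (AE \<omega> in P. f \<omega> \<in> S)}"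

definition Lp_converges ::
  "nat \<Rightarrow> 'w measure \<Rightarrow> (nat \<Rightarrow> 'w \<Rightarrow> 'a::real_normed_vector) \<Rightarrow> ('w \<Rightarrow> 'a) \<Rightarrow> bool" where
  "Lp_converges p P X x \<longleftrightarrow> (\<forall>n. X n \<in> Lp p P UNIV) \<and> x \<in> Lp p P UNIV \<and>
     (\<lambda>n. root p (\<integral>\<omega>. norm (X n \<omega> - x \<omega>) ^ p \<partial>P)) \<longlonglongrightarrow> 0"

(* L^2 is a Hilbert space with inner product E<f,g>, so its weak topology is the one
   induced by the functionals E<_,u>, as in weakly_converges. *)
definition L2_weakly_converges ::
  "'w measure \<Rightarrow> (nat \<Rightarrow> 'w \<Rightarrow> 'a::real_inner) \<Rightarrow> ('w \<Rightarrow> 'a) \<Rightarrow> bool" where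
  "L2_weakly_converges P X x \<longleftrightarrow> (\<forall>n. X n \<in> Lp 2 P UNIV) \<and> x \<in> Lp 2 P UNIV \<and>
     (\<forall>u\<in>Lp 2 P UNIV.
        (\<lambda>n. \<integral>\<omega>. inner (X n \<omega>) (u \<omega>) \<partial>P) \<longlonglongrightarrow> (\<integral>\<omega>. inner (x \<omega>) (u \<omega>) \<partial>P))"

definition sigma_rv :: "'w measure \<Rightarrow> 'b measure \<Rightarrow> ('w \<Rightarrow> 'b) \<Rightarrow> 'w set set" where
  "sigma_rv P N f = sets (vimage_algebra (space P) f N)"

(* As a measure-typed object, only the space and the sigma-algebra of history matter. *)
definition history :: "'w measure \<Rightarrow> (nat \<Rightarrow> 'w \<Rightarrow> 'a::topological_space) \<Rightarrow> nat \<Rightarrow> 'w measure" where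
  "history P x n = sigma (space P) (\<Union>j\<in>{..n}. sigma_rv P borel (x j))"

end

theory Submission
  imports Defs "HOL-Library.Diagonal_Subsequence"
begin

text \<open>
  The relaxation parameters may exceed \<open>2\<close>, so a single step can move the iterate away from the
  set \<open>Z\<close> of almost sure fixed points. What survives pathwise is the estimate
  \<open>\<parallel>x\<^sub>n\<^sub>+\<^sub>1 - z\<parallel>\<^sup>2 \<le> \<parallel>x\<^sub>n - z\<parallel>\<^sup>2 - \<lambda>\<^sub>n (2 - \<lambda>\<^sub>n) \<parallel>a\<^sub>n - x\<^sub>n\<parallel>\<^sup>2\<close> for \<open>z\<close> in \<open>Z\<close>
  (lemmas \<open>extrapolated_step\<close> and \<open>relaxed_step\<close>), which is geometry: the extrapolated point \<open>a\<^sub>n\<close> is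
  the projection of \<open>x\<^sub>n\<close> onto a half-space containing all points of \<open>Z\<close> that the selected operators
  fix. Since \<open>\<lambda>\<^sub>n\<close> is independent of everything else in the step, integrating over an event of the
  past replaces \<open>\<lambda>\<^sub>n (2 - \<lambda>\<^sub>n)\<close> by its mean, which is at least \<open>\<mu> > 0\<close>.

  Two consequences carry the proof. First, the squared displacements \<open>\<parallel>a\<^sub>n - x\<^sub>n\<parallel>\<^sup>2\<close> have a summable
  sequence of means, hence are almost surely summable. So almost every trajectory is quasi-Fejer
  monotone with the summable errors \<open>\<rho>\<^sup>2 \<parallel>a\<^sub>n - x\<^sub>n\<parallel>\<^sup>2\<close>, its distances to the points of \<open>Z\<close> converge, and
  its squared distances to a given \<open>z\<close> in \<open>Z\<close> lie below one integrable function, so that every passage from almost sure to mean convergence is dominated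
  convergence. Second, the displacement dominates \<open>\<delta>\<close> times the squared residual of the first selected
  operator, whose index is a copy of \<open>k\<close> independent of the past; therefore the mean residual
  \<open>r(y) = E \<parallel>T\<^sub>k y - y\<parallel>\<^sup>2\<close> satisfies \<open>r(x\<^sub>n) \<rightarrow> 0\<close> almost surely. Fix a trajectory with this property.
  Along a subsequence, \<open>T\<^sub>k x\<^sub>n - x\<^sub>n \<rightarrow> 0\<close> for almost every value of \<open>k\<close>, so demiclosedness places every
  weak cluster point in \<open>Z\<close>, and Opial's lemma (\<open>opial_weak_convergence\<close>) gives the weak limit. If
  the values of \<open>k\<close> that give a demiregular operator have positive probability, one of them can be
  chosen among those for which \<open>T\<^sub>k x\<^sub>n - x\<^sub>n \<rightarrow> 0\<close>, and the convergence is strong.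

  For the rates, the inequality integrated over events of the past is applied to a countable
  partition on which \<open>x\<^sub>n\<close> is almost optimally approximated by a fixed \<open>z\<^sub>j\<close> in a countable dense
  subset of \<open>Z\<close> (\<open>integral_le_by_near_selection\<close>). It replaces the random projection of \<open>x\<^sub>n\<close> onto \<open>Z\<close>
  and yields both the mean decrease of \<open>d\<^sub>Z(x\<^sub>n)\<^sup>2\<close> and the bound
  \<open>E \<parallel>x\<^sub>n\<^sub>+\<^sub>j - x\<^sub>n\<parallel>\<^sup>2 \<le> 4 E d\<^sub>Z(x\<^sub>n)\<^sup>2\<close>. Letting \<open>j\<close> tend to infinity bounds the distance to the limit, and
  a geometric decay of \<open>E d\<^sub>Z(x\<^sub>n)\<^sup>2\<close> becomes a geometric rate of convergence.
\<close>

section \<open>Inequalities for norms and scalar products\<close>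

lemma norm_add_sq_le:
  fixes u v :: "'a::real_inner"
  shows "(norm (u + v))\<^sup>2 \<le> 2 * (norm u)\<^sup>2 + 2 * (norm v)\<^sup>2"
proof -
  have "0 \<le> (norm (u - v))\<^sup>2" by simp
  then show ?thesis
    by (simp add: power2_norm_eq_inner inner_add_left inner_add_right inner_diff_left
        inner_diff_right inner_commute)
qed

lemma norm_diff_sq_le:
  fixes u v w :: "'a::real_inner"
  shows "(norm (u - v))\<^sup>2 \<le> 2 * (norm (u - w))\<^sup>2 + 2 * (norm (v - w))\<^sup>2"
  using norm_add_sq_le[of "u - w" "w - v"] by (simp add: norm_minus_commute)

lemma abs_inner_le_half_sum_sq:
  fixes u v :: "'a::real_inner"
  shows "\<bar>inner v u\<bar> \<le> (norm v)\<^sup>2 / 2 + (norm u)\<^sup>2 / 2"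
proof -
  have "0 \<le> (norm v - norm u)\<^sup>2" by simp
  with Cauchy_Schwarz_ineq2[of v u] show ?thesis by (simp add: power2_diff)
qed

lemma le_one_add_sq:
  fixes t :: real
  shows "t \<le> 1 + t\<^sup>2"
proof -
  have "0 \<le> (t - 1)\<^sup>2" by simp
  then have "2 * t \<le> t\<^sup>2 + 1" by (simp add: power2_diff)
  with zero_le_power2[of t] show ?thesis by linarith
qed

lemma norm_le_of_inner_ge:
  fixes v w :: "'a::real_inner"
  assumes "(norm v)\<^sup>2 \<le> inner w v"
  shows "norm v \<le> norm w"
proof -
  have "norm v * norm v \<le> norm w * norm v"
    using assms norm_cauchy_schwarz[of w v] by (simp add: power2_eq_square)
  then show ?thesis by (cases "v = 0") auto
qed

section \<open>Weak convergence in separable Hilbert spaces\<close>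

lemma LIMSEQ_subsequence_principle:
  fixes f :: "nat \<Rightarrow> 'b::topological_space"
  assumes "\<And>r::nat \<Rightarrow> nat. strict_mono r \<Longrightarrow> \<exists>s. strict_mono s \<and> (f \<circ> r \<circ> s) \<longlonglongrightarrow> l"
  shows "f \<longlonglongrightarrow> l"
proof (rule topological_tendstoI, rule ccontr)
  fix U assume U: "open U" "l \<in> U" and "\<not> eventually (\<lambda>n. f n \<in> U) sequentially"
  then have "\<exists>\<^sub>F n in sequentially. f n \<notin> U"
    by (simp add: frequently_def)
  then have "infinite {n. f n \<notin> U}"
    by (simp add: frequently_cofinite flip: cofinite_eq_sequentially)
  then obtain r :: "nat \<Rightarrow> nat" where r: "strict_mono r" "\<And>n. r n \<in> {n. f n \<notin> U}"
    using infinite_enumerate by blast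
  obtain s where s: "(f \<circ> r \<circ> s) \<longlonglongrightarrow> l"
    using assms[OF r(1)] by blast
  have "eventually (\<lambda>n. (f \<circ> r \<circ> s) n \<in> U) sequentially"
    using s U by (rule topological_tendstoD)
  with r(2) show False by simp
qed

text \<open>The functional \<open>f\<close> is represented by the minimiser of \<open>J v = \<parallel>v\<parallel>\<^sup>2 - 2 f v\<close>, because the derivative of
  \<open>J\<close> vanishes there. The parallelogram law makes every minimising sequence a Cauchy sequence.\<close>

lemma riesz_representation:
  fixes f :: "'a::{real_inner,complete_space} \<Rightarrow> real"
  assumes "bounded_linear f"
  obtains y where "\<And>u. f u = inner y u"
proof -
  interpret f: bounded_linear f by fact
  define J where "J v = (norm v)\<^sup>2 - 2 * f v" for v
  obtain B where B: "\<And>v. norm (f v) \<le> norm v * B"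
    using f.bounded by blast
  have J_ge: "J v \<ge> - B\<^sup>2" for v
  proof -
    have "f v \<le> norm v * B" using B[of v] by simp
    moreover have "0 \<le> (norm v - B)\<^sup>2" by simp
    ultimately show ?thesis by (simp add: J_def power2_diff)
  qed
  then have bdd: "bdd_below (range J)" by (intro bdd_belowI[of _ "- B\<^sup>2"]) auto
  define I where "I = (INF v. J v)"
  have I_le: "I \<le> J v" for v
    unfolding I_def by (rule cINF_lower[OF bdd]) simp
  have "\<exists>v. J v < I + 1 / real (Suc n)" for n
    using cINF_less_iff[OF UNIV_not_empty bdd, of "I + 1 / real (Suc n)"] by (auto simp: I_def)
  then obtain w where w: "\<And>n. J (w n) < I + 1 / real (Suc n)" by metis
  have mid: "(norm (b - c))\<^sup>2 \<le> 2 * (J b + J c - 2 * I)" for b c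
  proof -
    define h where "h = (1/2) *\<^sub>R (b + c)"
    have "J b + J c - 2 * J h = (norm (b - c))\<^sup>2 / 2"
      by (simp add: h_def J_def f.scaleR f.add power2_norm_eq_inner algebra_simps inner_commute
          inner_add_left inner_add_right inner_diff_left inner_diff_right)
    with I_le[of h] show ?thesis by (simp add: field_simps)
  qed
  have "Cauchy w"
  proof (rule metric_CauchyI)
    fix e :: real assume e: "0 < e"
    obtain N where N: "1 / real (Suc N) < e\<^sup>2 / 4"
      using nat_approx_posE[of "e\<^sup>2 / 4"] e by auto
    show "\<exists>M. \<forall>m\<ge>M. \<forall>n\<ge>M. dist (w m) (w n) < e"
    proof (intro exI allI impI)
      fix i j assume "N \<le> i" "N \<le> j"
      then have "1 / real (Suc i) \<le> 1 / real (Suc N)" "1 / real (Suc j) \<le> 1 / real (Suc N)"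
        by (auto simp: frac_le)
      with w[of i] w[of j] N have "J (w i) < I + e\<^sup>2 / 4" "J (w j) < I + e\<^sup>2 / 4" by linarith+
      with mid[of "w i" "w j"] have "(norm (w i - w j))\<^sup>2 < e\<^sup>2" by (simp add: field_simps)
      with e show "dist (w i) (w j) < e" by (simp add: dist_norm power2_less_imp_less)
    qed
  qed
  then obtain y where y: "w \<longlonglongrightarrow> y"
    using Cauchy_convergent_iff convergent_def by blast
  have "(\<lambda>n. J (w n)) \<longlonglongrightarrow> J y"
    unfolding J_def by (intro tendsto_intros y f.tendsto)
  moreover have "(\<lambda>n. I + 1 / real (Suc n)) \<longlonglongrightarrow> I + 0"
    by (intro tendsto_intros LIMSEQ_Suc[OF lim_1_over_n])
  ultimately have "J y \<le> I + 0"
    using w by (blast intro: LIMSEQ_le less_imp_le)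
  then have min: "J y \<le> J v" for v using I_le[of v] by simp
  \<comment> \<open>The quadratic \<open>t \<mapsto> J (y + t u)\<close> is minimal at \<open>0\<close>; the value at \<open>t = - c / N\<close> then forces its slope \<open>2 c\<close> to be \<open>0\<close>.\<close>
  have "f u = inner y u" for u
  proof -
    define c where "c = inner y u - f u"
    define N where "N = (norm u)\<^sup>2 + 1"
    have N: "N \<ge> 1" by (simp add: N_def)
    have J_line: "J (y + t *\<^sub>R u) = J y + 2 * t * c + t\<^sup>2 * (norm u)\<^sup>2" for t
      unfolding J_def c_def f.add f.scaleR power2_norm_eq_inner
      by (simp add: algebra_simps inner_add_left inner_add_right inner_commute power2_eq_square)
    have "0 \<le> 2 * (- c / N) * c + (- c / N)\<^sup>2 * (N - 1)"
      using min[of "y + (- c / N) *\<^sub>R u"] unfolding J_line by (simp add: N_def)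
    also have "\<dots> = - 2 * c\<^sup>2 / N + c\<^sup>2 * (N - 1) / N\<^sup>2"
      by (simp add: power2_eq_square)
    also have "\<dots> = - (c\<^sup>2 * (N + 1)) / N\<^sup>2"
      using N by (simp add: field_simps power2_eq_square)
    finally have "c\<^sup>2 * (N + 1) \<le> 0"
      using N by (simp add: divide_le_0_iff zero_le_divide_iff)
    then have "c = 0" using N by (simp add: mult_le_0_iff)
    then show ?thesis by (simp add: c_def)
  qed
  then show ?thesis by (rule that)
qed

text \<open>A diagonal subsequence makes the scalar products with a countable dense set converge. Boundedness
  extends this to all vectors, and the limits form a bounded linear functional, which the
  representation theorem turns into a weak limit.\<close>

lemma bounded_imp_weakly_convergent_subsequence:
  fixes X :: "nat \<Rightarrow> 'a::{real_inner,complete_space,second_countable_topology}"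
  assumes bnd: "\<And>n. norm (X n) \<le> B"
  obtains r y where "strict_mono r" "weakly_converges (X \<circ> r) y"
proof -
  obtain D :: "'a set" where D: "countable D" "\<And>U. open U \<Longrightarrow> U \<noteq> {} \<Longrightarrow> \<exists>d\<in>D. d \<in> U"
    using countable_dense_setE by blast
  then have "D \<noteq> {}" using open_UNIV by blast
  define d where "d = from_nat_into D"
  have d_dense: "\<exists>i. d i \<in> U" if "open U" "U \<noteq> {}" for U
    using D(2)[OF that] from_nat_into_surj[OF D(1)] unfolding d_def by metis
  have B0: "0 \<le> B" using bnd[of 0] norm_ge_zero order_trans by blast
  have inner_le: "\<bar>inner (X n) u\<bar> \<le> B * norm u" for n u
    using Cauchy_Schwarz_ineq2[of "X n" u] bnd[of n] by (meson mult_right_mono norm_ge_zero order_trans)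
  interpret subseqs "\<lambda>i s. convergent (\<lambda>n. inner (X (s n)) (d i))"
  proof
    fix i and s :: "nat \<Rightarrow> nat" assume "strict_mono s"
    have "bounded (range (\<lambda>n. inner (X (s n)) (d i)))"
      using inner_le by (intro boundedI[of _ "B * norm (d i)"]) auto
    from bounded_imp_convergent_subsequence[OF this]
    show "\<exists>r'. strict_mono r' \<and> convergent (\<lambda>n. inner (X ((s \<circ> r') n)) (d i))"
      by (auto simp: convergent_def o_def)
  qed
  define r where "r = diagseq"
  have r: "strict_mono r" unfolding r_def by (rule subseq_diagseq)
  have conv_d: "convergent (\<lambda>n. inner (X (r n)) (d i))" for i
  proof -
    have "convergent (\<lambda>n. inner (X ((diagseq \<circ> (+) (Suc i)) n)) (d i))"
    proof (rule diagseq_holds)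
      fix n and s t :: "nat \<Rightarrow> nat"
      assume "strict_mono t" and "convergent (\<lambda>m. inner (X (s m)) (d n))"
      then show "convergent (\<lambda>m. inner (X ((s \<circ> t) m)) (d n))"
        using convergent_subseq_convergent[of "\<lambda>m. inner (X (s m)) (d n)" t] by (simp add: o_def)
    qed
    then have "convergent (\<lambda>n. inner (X (r (n + Suc i))) (d i))"
      by (simp add: o_def r_def add.commute)
    then show ?thesis
      using convergent_ignore_initial_segment[of "\<lambda>n. inner (X (r n)) (d i)" "Suc i"] by simp
  qed
  have conv: "convergent (\<lambda>n. inner (X (r n)) u)" for u
  proof (rule Cauchy_convergent, rule metric_CauchyI)
    fix e :: real assume e: "0 < e"
    have "u \<in> ball u (e / (4 * (B + 1)))" using e B0 by simp
    then obtain i where i: "d i \<in> ball u (e / (4 * (B + 1)))"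
      using d_dense[OF open_ball] by blast
    have "norm (u - d i) * (B + 1) < e / 4"
      using i e B0 by (simp add: dist_norm field_simps)
    moreover have "norm (u - d i) * B \<le> norm (u - d i) * (B + 1)"
      by (intro mult_left_mono) auto
    ultimately have near: "B * norm (u - d i) < e / 4" by (simp add: mult.commute)
    obtain M where M: "\<And>j l. M \<le> j \<Longrightarrow> M \<le> l \<Longrightarrow> dist (inner (X (r j)) (d i)) (inner (X (r l)) (d i)) < e / 4"
      using metric_CauchyD[OF convergent_Cauchy[OF conv_d], of "e / 4" i] e by auto
    show "\<exists>M. \<forall>j\<ge>M. \<forall>l\<ge>M. dist (inner (X (r j)) u) (inner (X (r l)) u) < e"
    proof (intro exI allI impI)
      fix j l assume "M \<le> j" "M \<le> l"
      have "inner (X (r j)) u = inner (X (r j)) (d i) + inner (X (r j)) (u - d i)"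
        "inner (X (r l)) u = inner (X (r l)) (d i) + inner (X (r l)) (u - d i)"
        by (simp_all add: inner_diff_right)
      with M[OF \<open>M \<le> j\<close> \<open>M \<le> l\<close>] near inner_le[of "r j" "u - d i"] inner_le[of "r l" "u - d i"]
      show "dist (inner (X (r j)) u) (inner (X (r l)) u) < e"
        unfolding dist_real_def by linarith
    qed
  qed
  define f where "f u = lim (\<lambda>n. inner (X (r n)) u)" for u
  have f: "(\<lambda>n. inner (X (r n)) u) \<longlonglongrightarrow> f u" for u
    using conv convergent_LIMSEQ_iff unfolding f_def by blast
  have "bounded_linear f"
  proof (rule bounded_linear_intro)
    show "f (u + v) = f u + f v" for u v
      using tendsto_add[OF f[of u] f[of v]] f[of "u + v"]
      by (simp add: inner_add_right LIMSEQ_unique)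
    show "f (c *\<^sub>R u) = c *\<^sub>R f u" for c u
      using tendsto_mult_left[OF f[of u], of c] f[of "c *\<^sub>R u"]
      by (simp add: LIMSEQ_unique)
    show "norm (f u) \<le> norm u * B" for u
      using tendsto_norm[OF f[of u]] inner_le[of _ u]
      by (intro LIMSEQ_le_const2) (auto simp: mult.commute)
  qed
  then obtain y where "\<And>u. f u = inner y u"
    using riesz_representation by blast
  with f have "weakly_converges (X \<circ> r) y" by (simp add: weakly_converges_def)
  with r show ?thesis by (rule that)
qed

lemma weakly_converges_subseq:
  assumes "weakly_converges X y" "strict_mono r"
  shows "weakly_converges (X \<circ> r) y"
  using assms LIMSEQ_subseq_LIMSEQ[OF _ assms(2)]
  unfolding weakly_converges_def by (force simp: o_def)

lemma weakly_converges_norm_le: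
  assumes "weakly_converges X y" "\<And>n. norm (X n) \<le> B"
  shows "norm y \<le> B"
proof -
  have "inner (X n) y \<le> B * norm y" for n
    by (rule order_trans[OF norm_cauchy_schwarz]) (intro mult_right_mono assms(2) norm_ge_zero)
  then have "inner y y \<le> B * norm y"
    using assms(1) unfolding weakly_converges_def by (blast intro: LIMSEQ_le_const2)
  then have "norm y * norm y \<le> B * norm y"
    by (simp add: power2_norm_eq_inner[symmetric] power2_eq_square)
  moreover have "0 \<le> B" using assms(2)[of 0] norm_ge_zero order_trans by blast
  ultimately show ?thesis by (cases "norm y = 0") auto
qed

text \<open>If \<open>y\<close> and \<open>y'\<close> are weak cluster points in \<open>Z\<close>, then \<open>\<parallel>X\<^sub>n - y\<parallel>\<^sup>2 - \<parallel>X\<^sub>n - y'\<parallel>\<^sup>2\<close> converges, and up to a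
  constant it equals \<open>- 2 \<langle>X\<^sub>n, y - y'\<rangle>\<close>. The latter has the limits obtained along both subsequences,
  whence \<open>\<langle>y, y - y'\<rangle> = \<langle>y', y - y'\<rangle>\<close> and \<open>y = y'\<close>. Weak compactness does the rest.\<close>

lemma opial_weak_convergence:
  fixes X :: "nat \<Rightarrow> 'a::{real_inner,complete_space,second_countable_topology}"
  assumes "Z \<noteq> {}"
    and dist: "\<And>z. z \<in> Z \<Longrightarrow> convergent (\<lambda>n. norm (X n - z))"
    and cluster: "\<And>r y. strict_mono r \<Longrightarrow> weakly_converges (X \<circ> r) y \<Longrightarrow> y \<in> Z"
  obtains y where "y \<in> Z" "weakly_converges X y"
proof -
  obtain z where z: "z \<in> Z" using \<open>Z \<noteq> {}\<close> by blast
  obtain C where C: "\<And>n. norm (X n - z) \<le> C"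
    using convergent_imp_Bseq[OF dist[OF z]] by (auto simp: Bseq_def)
  have bnd: "norm (X n) \<le> C + norm z" for n
    using norm_triangle_ineq[of "X n - z" z] C[of n] by simp
  have unique: "y = y'"
    if r: "strict_mono r" "weakly_converges (X \<circ> r) y"
      and s: "strict_mono s" "weakly_converges (X \<circ> s) y'" for r s y y'
  proof -
    have "y \<in> Z" "y' \<in> Z" using cluster r s by blast+
    then obtain l l' where l: "(\<lambda>n. norm (X n - y)) \<longlonglongrightarrow> l" "(\<lambda>n. norm (X n - y')) \<longlonglongrightarrow> l'"
      using dist unfolding convergent_def by blast
    have "inner (X n) (y - y')
        = ((norm (X n - y'))\<^sup>2 - (norm (X n - y))\<^sup>2 + (norm y)\<^sup>2 - (norm y')\<^sup>2) / 2" for n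
      by (simp add: power2_norm_eq_inner algebra_simps inner_diff_left inner_diff_right inner_commute)
    moreover have "(\<lambda>n. ((norm (X n - y'))\<^sup>2 - (norm (X n - y))\<^sup>2 + (norm y)\<^sup>2 - (norm y')\<^sup>2) / 2)
        \<longlonglongrightarrow> (l'\<^sup>2 - l\<^sup>2 + (norm y)\<^sup>2 - (norm y')\<^sup>2) / 2"
      by (intro tendsto_intros l) simp
    ultimately have lim: "(\<lambda>n. inner (X n) (y - y')) \<longlonglongrightarrow> (l'\<^sup>2 - l\<^sup>2 + (norm y)\<^sup>2 - (norm y')\<^sup>2) / 2"
      by (simp only:)
    have "(\<lambda>n. inner (X (r n)) (y - y')) \<longlonglongrightarrow> inner y (y - y')"
      "(\<lambda>n. inner (X (s n)) (y - y')) \<longlonglongrightarrow> inner y' (y - y')"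
      using r(2) s(2) by (simp_all add: weakly_converges_def)
    with LIMSEQ_subseq_LIMSEQ[OF lim r(1)] LIMSEQ_subseq_LIMSEQ[OF lim s(1)]
    have "inner y (y - y') = inner y' (y - y')"
      by (simp add: o_def) (metis LIMSEQ_unique)
    then have "inner (y - y') (y - y') = 0" by (simp add: inner_diff_left)
    then show ?thesis by simp
  qed
  obtain r y where ry: "strict_mono r" "weakly_converges (X \<circ> r) y"
    by (rule bounded_imp_weakly_convergent_subsequence[OF bnd])
  have "(\<lambda>n. inner (X n) u) \<longlonglongrightarrow> inner y u" for u
  proof (rule LIMSEQ_subsequence_principle)
    fix t :: "nat \<Rightarrow> nat" assume t: "strict_mono t"
    have "norm ((X \<circ> t) n) \<le> C + norm z" for n by (simp add: bnd)
    from bounded_imp_weakly_convergent_subsequence[OF this]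
    obtain s y' where s: "strict_mono s" "weakly_converges ((X \<circ> t) \<circ> s) y'" .
    then have "y' = y"
      using unique[of "t \<circ> s" y' r y] ry t by (simp add: o_assoc strict_mono_o)
    with s show "\<exists>s. strict_mono s \<and> ((\<lambda>n. inner (X n) u) \<circ> t \<circ> s) \<longlonglongrightarrow> inner y u"
      by (auto simp: weakly_converges_def o_def)
  qed
  then have "weakly_converges X y" by (simp add: weakly_converges_def)
  with cluster[OF ry] show ?thesis by (rule that)
qed

text \<open>Subtracting the partial sums of the errors turns \<open>b\<close> into a decreasing sequence bounded below.\<close>

lemma quasi_fejer_convergent:
  fixes b e :: "nat \<Rightarrow> real"
  assumes b: "\<And>n. 0 \<le> b n" and e: "\<And>n. 0 \<le> e n" "summable e"
    and step: "\<And>n. b (Suc n) \<le> b n + e n"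
  shows "convergent b"
proof -
  define c where "c n = b n - (\<Sum>i<n. e i)" for n
  have "decseq c"
    using step by (intro decseq_SucI) (simp add: c_def algebra_simps)
  moreover have "\<forall>n. - suminf e \<le> c n"
  proof
    show "- suminf e \<le> c n" for n
      using b[of n] sum_le_suminf[OF e(2), of "{..<n}"] e(1) by (simp add: c_def)
  qed
  ultimately obtain l where "c \<longlonglongrightarrow> l" by (rule decseq_convergent)
  then have "(\<lambda>n. c n + (\<Sum>i<n. e i)) \<longlonglongrightarrow> l + suminf e"
    by (intro tendsto_add summable_LIMSEQ e)
  then show ?thesis by (auto simp: c_def convergent_def)
qed

text \<open>Weak limits of measurable functions are only known to be measurable after testing against vectors.
  That suffices in the separable case: \<open>\<parallel>w\<parallel> \<le> r\<close> means \<open>\<langle>w, d\<rangle> \<le> r \<parallel>d\<parallel>\<close> for all \<open>d\<close> in a countable dense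
  set, so preimages of closed balls are measurable, and open sets are countable unions of such balls.\<close>

lemma borel_measurable_weakI:
  fixes f :: "'w \<Rightarrow> 'a::{real_inner,second_countable_topology}"
  assumes [measurable]: "\<And>u. (\<lambda>\<omega>. inner (f \<omega>) u) \<in> borel_measurable M"
  shows "f \<in> borel_measurable M"
proof -
  obtain D :: "'a set" where D: "countable D" "\<And>U. open U \<Longrightarrow> U \<noteq> {} \<Longrightarrow> \<exists>d\<in>D. d \<in> U"
    using countable_dense_setE by blast
  have closure_D: "closure D = UNIV"
  proof (rule ccontr)
    assume "closure D \<noteq> UNIV"
    then obtain d where "d \<in> D" "d \<in> - closure D"
      using D(2)[of "- closure D"] by (auto simp: open_Compl)
    with closure_subset show False by blast
  qed
  have norm_le: "norm w \<le> r \<longleftrightarrow> (\<forall>d\<in>D. inner w d \<le> r * norm d)" if "0 \<le> r" for w :: 'a and r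
  proof
    assume "norm w \<le> r"
    then show "\<forall>d\<in>D. inner w d \<le> r * norm d"
      by (meson mult_right_mono norm_cauchy_schwarz norm_ge_zero order_trans)
  next
    assume *: "\<forall>d\<in>D. inner w d \<le> r * norm d"
    have "closed {d. inner w d \<le> r * norm d}"
      by (intro closed_Collect_le continuous_intros)
    with * have "closure D \<subseteq> {d. inner w d \<le> r * norm d}"
      by (intro closure_minimal) auto
    then have "inner w w \<le> r * norm w" using closure_D by auto
    then have "norm w * norm w \<le> r * norm w"
      by (simp add: power2_norm_eq_inner[symmetric] power2_eq_square)
    then show "norm w \<le> r" using that by (cases "w = 0") auto
  qed
  have cball: "f -` cball y r \<inter> space M \<in> sets M" for y r
  proof (cases "0 \<le> r")
    case True
    have "f -` cball y r \<inter> space M = {\<omega>\<in>space M. norm (f \<omega> - y) \<le> r}"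
      by (auto simp: dist_norm norm_minus_commute)
    also have "\<dots> = {\<omega>\<in>space M. \<forall>d\<in>D. inner (f \<omega>) d - inner y d \<le> r * norm d}"
      using norm_le[OF True] by (simp add: inner_diff_left)
    also have "\<dots> \<in> sets M"
      using D(1) by measurable
    finally show ?thesis .
  qed simp
  show ?thesis
  proof (rule borel_measurableI)
    fix U :: "'a set" assume "open U"
    let ?B = "{(d, n). d \<in> D \<and> cball d (1 / real (Suc n)) \<subseteq> U}"
    have "U \<subseteq> (\<Union>(d, n)\<in>?B. cball d (1 / real (Suc n)))"
    proof
      fix y assume "y \<in> U"
      then obtain e where e: "e > 0" "ball y e \<subseteq> U" using \<open>open U\<close> open_contains_ball by blast
      obtain n where n: "1 / real (Suc n) < e / 2" using nat_approx_posE[of "e / 2"] e by auto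
      obtain d where d: "d \<in> D" "d \<in> ball y (1 / real (Suc n))"
        using D(2)[of "ball y (1 / real (Suc n))"] by auto
      have "cball d (1 / real (Suc n)) \<subseteq> ball y e"
      proof
        fix v assume "v \<in> cball d (1 / real (Suc n))"
        then show "v \<in> ball y e"
          using n d(2) dist_triangle[of y v d] by (simp add: dist_commute)
      qed
      with e d have "(d, n) \<in> ?B" "y \<in> cball d (1 / real (Suc n))"
        by (auto simp: dist_commute less_imp_le)
      then show "y \<in> (\<Union>(d, n)\<in>?B. cball d (1 / real (Suc n)))" by blast
    qed
    then have U: "U = (\<Union>(d, n)\<in>?B. cball d (1 / real (Suc n)))" by auto
    have "countable ?B"
      by (rule countable_subset[of _ "D \<times> UNIV"]) (auto intro: D)
    then have "(\<Union>(d, n)\<in>?B. f -` cball d (1 / real (Suc n)) \<inter> space M) \<in> sets M"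
      using cball by (intro sets.countable_UN') auto
    also have "(\<Union>(d, n)\<in>?B. f -` cball d (1 / real (Suc n)) \<inter> space M) = f -` U \<inter> space M"
      by (subst U) auto
    finally show "f -` U \<inter> space M \<in> sets M" .
  qed
qed

section \<open>One relaxed and extrapolated block step\<close>

text \<open>Expanding \<open>\<parallel>T y - z\<parallel>\<^sup>2\<close> around \<open>y\<close> turns firm quasinonexpansiveness into the statement that the
  half-space \<open>{z. \<langle>z - y, T y - y\<rangle> \<ge> \<parallel>T y - y\<parallel>\<^sup>2}\<close>, onto which \<open>y\<close> projects at \<open>T y\<close>, contains the fixed points.\<close>

lemma fqn_inner_ge:
  fixes T :: "'a::real_inner \<Rightarrow> 'a"
  assumes "firmly_quasinonexpansive T" "z \<in> Fix T"
  shows "(norm (T y - y))\<^sup>2 \<le> inner (z - y) (T y - y)"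
proof -
  have "(norm (T y - z))\<^sup>2 + (norm (T y - y))\<^sup>2 \<le> (norm (y - z))\<^sup>2"
    using assms by (simp add: firmly_quasinonexpansive_def)
  then show ?thesis
    by (simp add: power2_norm_eq_inner inner_diff_left inner_diff_right inner_commute algebra_simps)
qed

lemma fqn_residual_le:
  fixes T :: "'a::real_inner \<Rightarrow> 'a"
  assumes "firmly_quasinonexpansive T" "z \<in> Fix T"
  shows "(norm (T y - y))\<^sup>2 \<le> (norm (y - z))\<^sup>2"
proof -
  have "(norm (T y - z))\<^sup>2 + (norm (T y - y))\<^sup>2 \<le> (norm (y - z))\<^sup>2"
    using assms by (simp add: firmly_quasinonexpansive_def)
  then show ?thesis using zero_le_power2[of "norm (T y - z)"] by linarith
qed

text \<open>Averaging the half-space inequalities of the \<open>q i\<close> gives \<open>\<langle>z - y, p - y\<rangle> \<ge> d\<close>, and \<open>L\<close> is the factor for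
  which \<open>y + L (p - y)\<close> is the projection of \<open>y\<close> onto that half-space. Since \<open>\<parallel>p - y\<parallel>\<^sup>2 \<le> d\<close> by convexity,
  \<open>L \<ge> 1\<close>, and the squared length \<open>L d\<close> of the step is at least \<open>d\<close>. If \<open>p = y\<close>, then \<open>d = 0\<close>, and
  division by zero gives \<open>L = 0\<close> and the correct step \<open>0\<close>.\<close>

lemma extrapolated_step:
  fixes I :: "'i set" and q :: "'i \<Rightarrow> 'a::real_inner" and \<beta> :: "'i \<Rightarrow> real" and y z :: 'a
  defines "p \<equiv> \<Sum>i\<in>I. \<beta> i *\<^sub>R q i"
    and "d \<equiv> \<Sum>i\<in>I. \<beta> i * (norm (q i - y))\<^sup>2"
  defines "L \<equiv> d / (norm (p - y))\<^sup>2"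
  assumes \<beta>: "\<And>i. i \<in> I \<Longrightarrow> 0 \<le> \<beta> i" "sum \<beta> I = 1"
    and q: "\<And>i. i \<in> I \<Longrightarrow> (norm (q i - y))\<^sup>2 \<le> inner (z - y) (q i - y)"
  shows "d \<le> (norm (L *\<^sub>R (p - y)))\<^sup>2"
    and "(norm (L *\<^sub>R (p - y)))\<^sup>2 \<le> inner (z - y) (L *\<^sub>R (p - y))"
proof -
  have py: "p - y = (\<Sum>i\<in>I. \<beta> i *\<^sub>R (q i - y))"
    by (simp add: p_def scaleR_diff_right sum_subtractf \<beta>(2) flip: scaleR_left.sum)
  have inner_py: "inner (p - y) w = (\<Sum>i\<in>I. \<beta> i * inner (q i - y) w)" for w
    unfolding py inner_sum_left by simp
  have d0: "0 \<le> d" unfolding d_def by (intro sum_nonneg mult_nonneg_nonneg \<beta>) auto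
  have d_le: "d \<le> inner (z - y) (p - y)"
    unfolding d_def py inner_sum_right inner_scaleR_right by (intro sum_mono mult_left_mono q \<beta>)
  \<comment> \<open>The weighted variance of the block steps is \<open>d - \<parallel>p - y\<parallel>\<^sup>2\<close>.\<close>
  have "0 \<le> (\<Sum>i\<in>I. \<beta> i * (norm ((q i - y) - (p - y)))\<^sup>2)"
    by (intro sum_nonneg mult_nonneg_nonneg \<beta>) auto
  also have "\<dots> = (\<Sum>i\<in>I. \<beta> i * (norm (q i - y))\<^sup>2 - 2 * inner (\<beta> i *\<^sub>R (q i - y)) (p - y)
      + \<beta> i * (norm (p - y))\<^sup>2)"
    by (intro sum.cong refl)
      (simp add: power2_norm_eq_inner inner_diff_left inner_diff_right inner_commute algebra_simps)
  also have "\<dots> = d - (norm (p - y))\<^sup>2"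
    unfolding sum.distrib sum_subtractf d_def
    by (simp add: inner_py \<beta>(2) power2_norm_eq_inner flip: sum_distrib_left sum_distrib_right)
  finally have norm_le: "(norm (p - y))\<^sup>2 \<le> d" by simp
  have "d \<le> (norm (L *\<^sub>R (p - y)))\<^sup>2 \<and> (norm (L *\<^sub>R (p - y)))\<^sup>2 \<le> inner (z - y) (L *\<^sub>R (p - y))"
  proof (cases "p = y")
    case True
    with d_le d0 show ?thesis by simp
  next
    case False
    define N where "N = (norm (p - y))\<^sup>2"
    have N: "0 < N" "N \<le> d" using False norm_le by (auto simp: N_def)
    have L: "L = d / N" by (simp add: L_def N_def)
    have "1 \<le> L" using N by (simp add: L)
    have eq: "(norm (L *\<^sub>R (p - y)))\<^sup>2 = L * d"
      using N by (simp add: power_mult_distrib flip: N_def) (simp add: L power2_eq_square)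
    have "1 * d \<le> L * d" using \<open>1 \<le> L\<close> d0 by (rule mult_right_mono)
    moreover have "L * d \<le> L * inner (z - y) (p - y)"
      using d_le \<open>1 \<le> L\<close> by (intro mult_left_mono) auto
    ultimately show ?thesis unfolding eq by simp
  qed
  then show "d \<le> (norm (L *\<^sub>R (p - y)))\<^sup>2"
    "(norm (L *\<^sub>R (p - y)))\<^sup>2 \<le> inner (z - y) (L *\<^sub>R (p - y))" by auto
qed

text \<open>The indicators of \<open>p = y\<close> only guard against division by zero, and the vector that they scale is \<open>0\<close> in
  that case.\<close>

lemma extrapolation_of_bool:
  fixes p y :: "'a::real_inner"
  shows "((d + of_bool (p = y)) / ((norm (p - y))\<^sup>2 + of_bool (p = y))) *\<^sub>R (p - y)
    = (d / (norm (p - y))\<^sup>2) *\<^sub>R (p - y)"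
  by (cases "p = y") auto

text \<open>The summand of an index that attains the maximum alone suffices: its weight is at least \<open>\<delta>\<close> and its
  residual is the largest.\<close>

lemma block_residual_ge:
  fixes q :: "'i \<Rightarrow> 'a::real_inner" and \<beta> :: "'i \<Rightarrow> real"
  assumes I: "finite I" "j \<in> I" and \<beta>: "\<And>i. i \<in> I \<Longrightarrow> 0 \<le> \<beta> i" and "0 \<le> \<delta>"
    and max: "\<And>i. i \<in> I \<Longrightarrow>
      \<delta> * of_bool (norm (q i - y) = Max ((\<lambda>j. norm (q j - y)) ` I)) \<le> \<beta> i"
  shows "\<delta> * (norm (q j - y))\<^sup>2 \<le> (\<Sum>i\<in>I. \<beta> i * (norm (q i - y))\<^sup>2)"
proof -
  have "Max ((\<lambda>j. norm (q j - y)) ` I) \<in> (\<lambda>j. norm (q j - y)) ` I"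
    using I by (intro Max_in) auto
  then obtain l where l: "l \<in> I" "norm (q l - y) = Max ((\<lambda>j. norm (q j - y)) ` I)" by auto
  have "norm (q j - y) \<le> norm (q l - y)" unfolding l(2) using I by (intro Max_ge) auto
  then have "\<delta> * (norm (q j - y))\<^sup>2 \<le> \<delta> * (norm (q l - y))\<^sup>2"
    using \<open>0 \<le> \<delta>\<close> by (intro mult_left_mono power_mono) auto
  also have "\<dots> \<le> \<beta> l * (norm (q l - y))\<^sup>2"
    using max[OF l(1)] l(2) by (intro mult_right_mono) auto
  also have "\<dots> \<le> (\<Sum>i\<in>I. \<beta> i * (norm (q i - y))\<^sup>2)"
    by (rule member_le_sum[OF l(1)]) (use I \<beta> in auto)
  finally show ?thesis .
qed

lemma relaxed_step:
  fixes v y z :: "'a::real_inner"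
  assumes "(norm v)\<^sup>2 \<le> inner (z - y) v" "0 \<le> t"
  shows "(norm (y + t *\<^sub>R v - z))\<^sup>2 \<le> (norm (y - z))\<^sup>2 - t * (2 - t) * (norm v)\<^sup>2"
proof -
  have "(norm (y + t *\<^sub>R v - z))\<^sup>2 = (norm (y - z))\<^sup>2 - 2 * t * inner (z - y) v + t\<^sup>2 * (norm v)\<^sup>2"
    by (simp add: power2_norm_eq_inner inner_diff_left inner_diff_right inner_add_left inner_add_right
        inner_commute algebra_simps power2_eq_square[of t])
  also have "\<dots> \<le> (norm (y - z))\<^sup>2 - 2 * t * (norm v)\<^sup>2 + t\<^sup>2 * (norm v)\<^sup>2"
    using assms by (simp add: mult_left_mono)
  finally show ?thesis by (simp add: algebra_simps power2_eq_square)
qed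

section \<open>Countable dense subsets, summable integrals and countable covers\<close>

lemma countable_dense_subset:
  fixes S :: "'a::{metric_space,second_countable_topology} set"
  assumes "S \<noteq> {}"
  obtains d :: "nat \<Rightarrow> 'a" where "range d \<subseteq> S" "S \<subseteq> closure (range d)"
proof -
  obtain B :: "'a set set" where B: "countable B" "topological_basis B"
    using ex_countable_basis by blast
  define C where "C = {U \<in> B. U \<inter> S \<noteq> {}}"
  define g where "g U = (SOME y. y \<in> U \<inter> S)" for U
  have g: "g U \<in> U \<inter> S" if "U \<in> C" for U
    using that unfolding C_def g_def by (metis (mono_tags, lifting) ex_in_conv mem_Collect_eq someI_ex)
  have dense: "S \<subseteq> closure (g ` C)"
  proof
    fix y assume "y \<in> S"
    show "y \<in> closure (g ` C)"
      unfolding closure_iff_nhds_not_empty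
    proof (intro allI impI)
      fix A V assume V: "V \<subseteq> A" "open V" "y \<in> V"
      then obtain U where U: "U \<in> B" "y \<in> U" "U \<subseteq> V"
        using B(2) topological_basisE by blast
      with \<open>y \<in> S\<close> have "U \<in> C" by (auto simp: C_def)
      then show "g ` C \<inter> A \<noteq> {}" using g U V by blast
    qed
  qed
  then have "g ` C \<noteq> {}" using assms by auto
  moreover have "countable (g ` C)" using B(1) by (auto simp: C_def)
  ultimately have "range (from_nat_into (g ` C)) = g ` C" by (rule range_from_nat_into)
  then show ?thesis using dense g by (intro that[of "from_nat_into (g ` C)"]) auto
qed

text \<open>A dense sequence nearly attains the distance to \<open>Z\<close>; the error is put on the squares because these are integrated below.\<close>

lemma infdist_near_sq:
  fixes d :: "nat \<Rightarrow> 'a::metric_space"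
  assumes "Z \<noteq> {}" "Z \<subseteq> closure (range d)" "0 < \<epsilon>"
  obtains j where "(dist y (d j))\<^sup>2 \<le> (infdist y Z)\<^sup>2 + \<epsilon>"
proof -
  define r where "r = sqrt ((infdist y Z)\<^sup>2 + \<epsilon>)"
  have "infdist y Z < r"
    unfolding r_def using \<open>0 < \<epsilon>\<close> by (intro real_less_rsqrt) simp
  then obtain z where z: "z \<in> Z" "dist y z < r"
    using \<open>Z \<noteq> {}\<close> cINF_less_iff[of Z "dist y" r] by (auto simp: infdist_notempty)
  then have "z \<in> closure (range d)" using assms(2) by blast
  then obtain j where j: "dist (d j) z < r - dist y z"
    using z(2) closure_approachable[of z "range d"] by (metis diff_gt_0_iff_gt rangeE)
  have "dist y (d j) \<le> r"
    using dist_triangle[of y "d j" z] j by (simp add: dist_commute)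
  then have "(dist y (d j))\<^sup>2 \<le> r\<^sup>2" by (rule power_mono) simp
  also have "r\<^sup>2 = (infdist y Z)\<^sup>2 + \<epsilon>" unfolding r_def using \<open>0 < \<epsilon>\<close> by simp
  finally show ?thesis by (rule that)
qed

lemma borel_measurable_infdist [measurable (raw)]:
  "f \<in> borel_measurable M \<Longrightarrow> (\<lambda>\<omega>. infdist (f \<omega>) Z) \<in> borel_measurable M"
  by (rule borel_measurable_continuous_on[of "\<lambda>y. infdist y Z"]) (intro continuous_intros)

lemma linear_recursion_bound:
  fixes b :: "nat \<Rightarrow> real"
  assumes "\<And>n. b (Suc n) \<le> \<theta> * b n" "0 \<le> \<theta>"
  shows "b n \<le> \<theta> ^ n * b 0"
proof (induction n)
  case (Suc n)
  have "b (Suc n) \<le> \<theta> * (\<theta> ^ n * b 0)"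
    using assms(1)[of n] mult_left_mono[OF Suc assms(2)] by linarith
  then show ?case by (simp add: mult.assoc)
qed simp

lemma summable_integrals_imp_AE_summable:
  fixes f :: "nat \<Rightarrow> 'w \<Rightarrow> real"
  assumes f: "\<And>n. integrable M (f n)" "\<And>n \<omega>. 0 \<le> f n \<omega>"
    and summ: "summable (\<lambda>n. \<integral>\<omega>. f n \<omega> \<partial>M)"
  shows "AE \<omega> in M. summable (\<lambda>n. f n \<omega>)" "integrable M (\<lambda>\<omega>. \<Sum>n. f n \<omega>)"
proof -
  have [measurable]: "f n \<in> borel_measurable M" for n using f(1) by blast
  have nn: "(\<integral>\<^sup>+\<omega>. ennreal (f n \<omega>) \<partial>M) = ennreal (\<integral>\<omega>. f n \<omega> \<partial>M)" for n
    by (intro nn_integral_eq_integral f AE_I2)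
  have "(\<integral>\<^sup>+\<omega>. (\<Sum>n. ennreal (f n \<omega>)) \<partial>M) = (\<Sum>n. ennreal (\<integral>\<omega>. f n \<omega> \<partial>M))"
    by (subst nn_integral_suminf) (auto simp: nn)
  also have "\<dots> = ennreal (\<Sum>n. \<integral>\<omega>. f n \<omega> \<partial>M)"
    by (intro suminf_ennreal2 summ integral_nonneg_AE AE_I2 f)
  finally have "(\<integral>\<^sup>+\<omega>. (\<Sum>n. ennreal (f n \<omega>)) \<partial>M) \<noteq> \<infinity>" by simp
  then have "AE \<omega> in M. (\<Sum>n. ennreal (f n \<omega>)) \<noteq> \<infinity>"
    by (intro nn_integral_PInf_AE) auto
  then show AE: "AE \<omega> in M. summable (\<lambda>n. f n \<omega>)"
    by eventually_elim (auto intro: summable_suminf_not_top f)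
  then show "integrable M (\<lambda>\<omega>. \<Sum>n. f n \<omega>)"
    by (intro integrable_suminf f(1)) (simp_all add: f(2) summ)
qed

lemma integral_nonpos_of_countable_cover:
  fixes h :: "'w \<Rightarrow> real"
  assumes h: "integrable M h"
    and A: "\<And>j::nat. A j \<in> sets M" "disjoint_family A" "(\<Union>j. A j) = space M"
    and le: "\<And>j. (\<integral>\<omega>. indicator (A j) \<omega> * h \<omega> \<partial>M) \<le> 0"
  shows "(\<integral>\<omega>. h \<omega> \<partial>M) \<le> 0"
proof -
  have [measurable]: "A j \<in> sets M" for j by (rule A)
  have [measurable]: "h \<in> borel_measurable M" using h by blast
  have sums: "(\<lambda>j. indicator (A j) \<omega> :: real) sums 1" if "\<omega> \<in> space M" for \<omega>
    using indicator_sums[of A \<omega>] A(2,3) that by (auto simp: disjoint_family_on_def)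
  have ind: "\<bar>\<Sum>j<N. indicator (A j) \<omega> :: real\<bar> \<le> 1" if "\<omega> \<in> space M" for \<omega> N
    using sum_le_suminf[OF sums_summable[OF sums[OF that]], of "{..<N}"] sums_unique[OF sums[OF that]]
    by (simp add: sum_nonneg)
  have "(\<lambda>N. \<integral>\<omega>. (\<Sum>j<N. indicator (A j) \<omega>) * h \<omega> \<partial>M) \<longlonglongrightarrow> (\<integral>\<omega>. h \<omega> \<partial>M)"
  proof (rule integral_dominated_convergence)
    show "integrable M (\<lambda>\<omega>. \<bar>h \<omega>\<bar>)" using h by simp
    show "AE \<omega> in M. (\<lambda>N. (\<Sum>j<N. indicator (A j) \<omega>) * h \<omega>) \<longlonglongrightarrow> h \<omega>"
    proof (rule AE_I2)
      fix \<omega> assume "\<omega> \<in> space M"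
      from tendsto_mult[OF sums[OF this, unfolded sums_def] tendsto_const[of "h \<omega>"]]
      show "(\<lambda>N. (\<Sum>j<N. indicator (A j) \<omega>) * h \<omega>) \<longlonglongrightarrow> h \<omega>" by simp
    qed
    show "AE \<omega> in M. norm ((\<Sum>j<N. indicator (A j) \<omega>) * h \<omega>) \<le> \<bar>h \<omega>\<bar>" for N
    proof (rule AE_I2)
      fix \<omega> assume "\<omega> \<in> space M"
      from mult_right_mono[OF ind[OF this, of N], of "\<bar>h \<omega>\<bar>"]
      show "norm ((\<Sum>j<N. indicator (A j) \<omega>) * h \<omega>) \<le> \<bar>h \<omega>\<bar>" by (simp add: abs_mult)
    qed
  qed measurable
  moreover have "(\<integral>\<omega>. (\<Sum>j<N. indicator (A j) \<omega>) * h \<omega> \<partial>M) \<le> 0" for N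
  proof -
    have "integrable M (\<lambda>\<omega>. indicator (A j) \<omega> * h \<omega>)" for j
      using integrable_mult_indicator[OF A(1) h, of j] by simp
    then have "(\<integral>\<omega>. (\<Sum>j<N. indicator (A j) \<omega>) * h \<omega> \<partial>M)
        = (\<Sum>j<N. \<integral>\<omega>. indicator (A j) \<omega> * h \<omega> \<partial>M)"
      unfolding sum_distrib_right by (rule Bochner_Integration.integral_sum)
    then show ?thesis using le by (simp add: sum_nonpos)
  qed
  ultimately show ?thesis by (intro LIMSEQ_le_const2) auto
qed

section \<open>Generated and past sigma-algebras\<close>

lemma sigma_rv_subset_Pow: "sigma_rv P N f \<subseteq> Pow (space P)"
  unfolding sigma_rv_def using sets.space_closed[of "vimage_algebra (space P) f N"] by simp

lemma sigma_rv_subset: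
  assumes "f \<in> measurable P N"
  shows "sigma_rv P N f \<subseteq> sets P"
  unfolding sigma_rv_def using measurable_iff_sets[of f P N] assms by simp

lemma measurable_sigma_rv:
  assumes "f \<in> space P \<rightarrow> space N" "space M = space P" "sigma_rv P N f \<subseteq> sets M"
  shows "f \<in> measurable M N"
  using assms unfolding sigma_rv_def by (simp add: measurable_iff_sets)

lemma sigma_rv_eq: "sigma_rv P N f = sigma_sets (space P) {f -` A \<inter> space P |A. A \<in> sets N}"
  by (simp add: sigma_rv_def sets_vimage_algebra)

lemma sigma_rv_subset_of_measurable:
  assumes "f \<in> measurable G N" "space G = space P"
  shows "sigma_rv P N f \<subseteq> sets G"
  using assms measurable_iff_sets[of f G N] by (simp add: sigma_rv_def)

lemma space_history [simp]: "space (history P x n) = space P"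
  by (simp add: history_def space_measure_of_conv)

lemma sets_history:
  "sets (history P x n) = sigma_sets (space P) (\<Union>j\<in>{..n}. sigma_rv P borel (x j))"
  unfolding history_def using sigma_rv_subset_Pow by (intro sets_measure_of) blast

lemma measurable_history:
  assumes "j \<le> n"
  shows "x j \<in> borel_measurable (history P x n)"
  using assms by (intro measurable_sigma_rv[of _ P]) (auto simp: sets_history)

lemma history_mono:
  assumes "n \<le> n'"
  shows "sets (history P x n) \<subseteq> sets (history P x n')"
  unfolding sets_history using assms by (intro sigma_sets_mono') (auto intro: order_trans)

lemma history_subset:
  assumes "\<And>n. x n \<in> borel_measurable P"
  shows "sets (history P x n) \<subseteq> sets P"
  unfolding sets_history using sigma_rv_subset[OF assms] by (intro sets.sigma_sets_subset) blast

section \<open>Independence and null sets\<close>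

lemma (in complete_measure) borel_measurable_AE_eq:
  fixes f g :: "'a \<Rightarrow> 'b::topological_space"
  assumes f: "f \<in> borel_measurable M" and eq: "AE \<omega> in M. g \<omega> = f \<omega>"
  shows "g \<in> borel_measurable M"
proof (rule measurableI)
  fix U :: "'b set" assume "U \<in> sets borel"
  with f have sets: "f -` U \<inter> space M \<in> sets M" by (rule measurable_sets)
  have "AE \<omega> in M. \<omega> \<in> f -` U \<inter> space M \<longleftrightarrow> \<omega> \<in> g -` U \<inter> space M"
    using eq by eventually_elim auto
  from in_sets_AE[OF this sets] show "g -` U \<inter> space M \<in> sets M" by blast
qed simp

text \<open>Independence is given between \<open>\<sigma>(X)\<close> and a sigma-algebra containing \<open>\<sigma>(Y)\<close>, and \<open>X\<close> and \<open>Y\<close> may have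
  different types. Product and joint measure agree on rectangles, which determine them.\<close>

lemma (in prob_space) joint_distr_of_indep_set:
  assumes X [measurable]: "X \<in> measurable M S" and Y [measurable]: "Y \<in> measurable M N"
    and indep: "indep_set (sigma_rv M S X) B" and sub: "sigma_rv M N Y \<subseteq> B"
  shows "distr M S X \<Otimes>\<^sub>M distr M N Y = distr M (S \<Otimes>\<^sub>M N) (\<lambda>\<omega>. (X \<omega>, Y \<omega>))"
proof (rule pair_measure_eqI)
  interpret DX: prob_space "distr M S X" by (rule prob_space_distr) measurable
  interpret DY: prob_space "distr M N Y" by (rule prob_space_distr) measurable
  show "sigma_finite_measure (distr M S X)" "sigma_finite_measure (distr M N Y)"
    by unfold_locales
  fix A C assume "A \<in> sets (distr M S X)" "C \<in> sets (distr M N Y)"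
  then have [measurable]: "A \<in> sets S" "C \<in> sets N" by simp_all
  have "X -` A \<inter> space M \<in> sigma_rv M S X" "Y -` C \<inter> space M \<in> sigma_rv M N Y"
    unfolding sigma_rv_eq by (auto intro!: sigma_sets.Basic)
  with sub have "X -` A \<inter> space M \<in> sigma_rv M S X" "Y -` C \<inter> space M \<in> B"
    by auto
  then have "prob ((X -` A \<inter> space M) \<inter> (Y -` C \<inter> space M))
      = prob (X -` A \<inter> space M) * prob (Y -` C \<inter> space M)"
    by (rule indep_setD[OF indep])
  moreover have "(X -` A \<inter> space M) \<inter> (Y -` C \<inter> space M) = (\<lambda>\<omega>. (X \<omega>, Y \<omega>)) -` (A \<times> C) \<inter> space M"
    by auto
  ultimately show "emeasure (distr M S X) A * emeasure (distr M N Y) C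
      = emeasure (distr M (S \<Otimes>\<^sub>M N) (\<lambda>\<omega>. (X \<omega>, Y \<omega>))) (A \<times> C)"
    by (simp add: emeasure_distr emeasure_eq_measure ennreal_mult)
qed simp

lemma (in prob_space) integral_mult_of_indep_set:
  fixes X Y :: "'a \<Rightarrow> real"
  assumes "integrable M X" "integrable M Y"
    and indep: "indep_set A B" and sub: "sigma_rv M borel X \<subseteq> A" "sigma_rv M borel Y \<subseteq> B"
  shows "(\<integral>\<omega>. X \<omega> * Y \<omega> \<partial>M) = (\<integral>\<omega>. X \<omega> \<partial>M) * (\<integral>\<omega>. Y \<omega> \<partial>M)"
    and "integrable M (\<lambda>\<omega>. X \<omega> * Y \<omega>)"
proof -
  have "indep_var borel X borel Y"
    unfolding indep_var_eq sigma_rv_eq[symmetric]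
  proof (intro conjI)
    show "indep_set (sigma_rv M borel X) (sigma_rv M borel Y)"
      unfolding indep_set_def
      using indep[unfolded indep_set_def]
      by (rule indep_sets_mono_sets) (use sub in \<open>auto split: bool.split\<close>)
  qed (rule borel_measurable_integrable assms)+
  from indep_var_lebesgue_integral[OF this assms(1,2)] indep_var_integrable[OF this assms(1,2)]
  show "(\<integral>\<omega>. X \<omega> * Y \<omega> \<partial>M) = (\<integral>\<omega>. X \<omega> \<partial>M) * (\<integral>\<omega>. Y \<omega> \<partial>M)"
    "integrable M (\<lambda>\<omega>. X \<omega> * Y \<omega>)" by auto
qed

lemma (in prob_space) AE_positive_measure_witness:
  assumes "AE \<omega> in M. Q \<omega>" "S \<in> sets M" "0 < measure M S"
  obtains \<omega> where "\<omega> \<in> S" "Q \<omega>"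
proof -
  have "\<exists>\<omega>. \<omega> \<in> S \<and> Q \<omega>"
  proof (rule ccontr)
    assume "\<not> ?thesis"
    then have "AE \<omega> in M. \<omega> \<notin> S" using assms(1) by (auto elim!: eventually_mono)
    then show False using assms(2,3) prob_eq_0[OF assms(2)] by simp
  qed
  then show ?thesis using that by blast
qed

lemma (in prob_space) Lp_2_of_diff:
  fixes v :: "'a \<Rightarrow> 'b::real_inner"
  assumes [measurable]: "v \<in> borel_measurable M" and "integrable M (\<lambda>\<omega>. (norm (v \<omega> - z))\<^sup>2)"
  shows "v \<in> Lp 2 M UNIV"
proof -
  have "integrable M (\<lambda>\<omega>. (norm (v \<omega>))\<^sup>2)"
  proof (rule Bochner_Integration.integrable_bound)
    show "integrable M (\<lambda>\<omega>. 2 * (norm (v \<omega> - z))\<^sup>2 + 2 * (norm z)\<^sup>2)"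
      using assms by simp
    show "AE \<omega> in M. norm ((norm (v \<omega>))\<^sup>2) \<le> norm (2 * (norm (v \<omega> - z))\<^sup>2 + 2 * (norm z)\<^sup>2)"
      using norm_diff_sq_le[of _ 0 z] by (auto intro!: AE_I2)
  qed measurable
  then show ?thesis by (simp add: Lp_def)
qed

lemma (in prob_space) Lp_2_imp_Lp_1:
  fixes v :: "'a \<Rightarrow> 'b::real_normed_vector"
  assumes "v \<in> Lp 2 M UNIV"
  shows "v \<in> Lp 1 M UNIV"
proof -
  have [measurable]: "v \<in> borel_measurable M" and v: "integrable M (\<lambda>\<omega>. (norm (v \<omega>))\<^sup>2)"
    using assms by (auto simp: Lp_def)
  have "integrable M (\<lambda>\<omega>. norm (v \<omega>))"
  proof (rule Bochner_Integration.integrable_bound)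
    show "integrable M (\<lambda>\<omega>. 1 + (norm (v \<omega>))\<^sup>2)" using v by simp
    show "AE \<omega> in M. norm (norm (v \<omega>)) \<le> norm (1 + (norm (v \<omega>))\<^sup>2)"
      using le_one_add_sq by (auto intro!: AE_I2)
  qed measurable
  then show ?thesis by (simp add: Lp_def)
qed

lemma (in prob_space) relaxation_bounds:
  assumes "\<Lambda> \<in> Linf M {0<..\<rho>}"
  shows "\<Lambda> \<in> borel_measurable M" "AE \<omega> in M. 0 < \<Lambda> \<omega> \<and> \<Lambda> \<omega> \<le> \<rho>"
    and "integrable M (\<lambda>\<omega>. \<Lambda> \<omega> * (2 - \<Lambda> \<omega>))"
    and "- \<rho>\<^sup>2 \<le> (\<integral>\<omega>. \<Lambda> \<omega> * (2 - \<Lambda> \<omega>) \<partial>M)"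
    and "(\<integral>\<omega>. (\<Lambda> \<omega>)\<^sup>2 \<partial>M) \<le> \<rho>\<^sup>2"
proof -
  show [measurable]: "\<Lambda> \<in> borel_measurable M" and *: "AE \<omega> in M. 0 < \<Lambda> \<omega> \<and> \<Lambda> \<omega> \<le> \<rho>"
    using assms by (auto simp: Linf_def)
  have sq: "AE \<omega> in M. (\<Lambda> \<omega>)\<^sup>2 \<le> \<rho>\<^sup>2"
    using * by eventually_elim (auto intro: power_mono)
  have sq_int: "integrable M (\<lambda>\<omega>. (\<Lambda> \<omega>)\<^sup>2)"
    by (rule integrable_const_bound[where B = "\<rho>\<^sup>2"]) (use sq in auto)
  have int: "integrable M \<Lambda>"
    by (rule integrable_const_bound[where B = "\<rho>"]) (use * in auto)
  have eq: "\<Lambda> \<omega> * (2 - \<Lambda> \<omega>) = 2 * \<Lambda> \<omega> - (\<Lambda> \<omega>)\<^sup>2" for \<omega>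
    by (simp add: algebra_simps power2_eq_square)
  show int': "integrable M (\<lambda>\<omega>. \<Lambda> \<omega> * (2 - \<Lambda> \<omega>))"
    unfolding eq using sq_int int by simp
  have "(\<integral>\<omega>. - \<rho>\<^sup>2 \<partial>M) \<le> (\<integral>\<omega>. \<Lambda> \<omega> * (2 - \<Lambda> \<omega>) \<partial>M)"
  proof (rule integral_mono_AE[OF _ int'])
    show "AE \<omega> in M. - \<rho>\<^sup>2 \<le> \<Lambda> \<omega> * (2 - \<Lambda> \<omega>)"
      using * sq
    proof eventually_elim
      case (elim \<omega>)
      then show ?case unfolding eq by linarith
    qed
  qed simp
  then show "- \<rho>\<^sup>2 \<le> (\<integral>\<omega>. \<Lambda> \<omega> * (2 - \<Lambda> \<omega>) \<partial>M)" by (simp add: prob_space)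
  have "(\<integral>\<omega>. (\<Lambda> \<omega>)\<^sup>2 \<partial>M) \<le> (\<integral>\<omega>. \<rho>\<^sup>2 \<partial>M)"
    by (rule integral_mono_AE[OF sq_int _ sq]) simp
  then show "(\<integral>\<omega>. (\<Lambda> \<omega>)\<^sup>2 \<partial>M) \<le> \<rho>\<^sup>2" by (simp add: prob_space)
qed

section \<open>Stochastic quasi-Fejer monotone sequences\<close>

text \<open>Only the properties of the iteration that drive its convergence are kept: \<open>e n\<close> stands for the squared
  displacement in step \<open>n\<close>, and \<open>c\<close> bounds the factor by which a too long relaxation multiplies it.\<close>

locale pathwise_quasi_fejer = prob_space P for P :: "'w measure" +
  fixes x :: "nat \<Rightarrow> 'w \<Rightarrow> 'a::{real_inner,complete_space,second_countable_topology}"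
    and Z :: "'a set" and e :: "nat \<Rightarrow> 'w \<Rightarrow> real" and c :: real
  assumes x_rv [measurable]: "\<And>n. x n \<in> borel_measurable P"
    and e_rv [measurable]: "\<And>n. e n \<in> borel_measurable P"
    and e_nonneg: "\<And>n \<omega>. 0 \<le> e n \<omega>"
    and x0_sq: "integrable P (\<lambda>\<omega>. (norm (x 0 \<omega>))\<^sup>2)"
    and Z_nonempty: "Z \<noteq> {}"
    and c_nonneg: "0 \<le> c"
    and e_le: "\<And>n z. z \<in> Z \<Longrightarrow> AE \<omega> in P. e n \<omega> \<le> (norm (x n \<omega> - z))\<^sup>2"
    and step: "\<And>n z. z \<in> Z \<Longrightarrow>
      AE \<omega> in P. (norm (x (Suc n) \<omega> - z))\<^sup>2 \<le> (norm (x n \<omega> - z))\<^sup>2 + c * e n \<omega>"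
begin

text \<open>The two claims are proved together, since the induction step for the distances uses that the errors are dominated by them.\<close>

lemma integrable_dist_sq_and_e:
  assumes "z \<in> Z"
  shows "integrable P (\<lambda>\<omega>. (norm (x n \<omega> - z))\<^sup>2)" "integrable P (e n)"
proof -
  have e_int: "integrable P (e n)" if "integrable P (\<lambda>\<omega>. (norm (x n \<omega> - z))\<^sup>2)" for n
    by (rule Bochner_Integration.integrable_bound[OF that e_rv])
      (use e_le[OF assms, of n] in \<open>auto simp: e_nonneg\<close>)
  show *: "integrable P (\<lambda>\<omega>. (norm (x n \<omega> - z))\<^sup>2)"
  proof (induction n)
    case 0
    have "integrable P (\<lambda>\<omega>. 2 * (norm (x 0 \<omega>))\<^sup>2 + 2 * (norm z)\<^sup>2)"
      using x0_sq by simp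
    then show ?case
      by (rule Bochner_Integration.integrable_bound)
        (use norm_diff_sq_le[of _ z 0] in \<open>auto intro!: AE_I2\<close>)
  next
    case (Suc n)
    have "integrable P (\<lambda>\<omega>. (norm (x n \<omega> - z))\<^sup>2 + c * e n \<omega>)"
      using Suc e_int[OF Suc] by simp
    then show ?case
    proof (rule Bochner_Integration.integrable_bound)
      show "AE \<omega> in P. norm ((norm (x (Suc n) \<omega> - z))\<^sup>2) \<le> norm ((norm (x n \<omega> - z))\<^sup>2 + c * e n \<omega>)"
        using step[OF assms, of n] by eventually_elim auto
    qed measurable
  qed
  from e_int[OF *] show "integrable P (e n)" .
qed

lemma integrable_e: "integrable P (e n)"
  using Z_nonempty integrable_dist_sq_and_e(2) by blast

lemmas integrable_dist_sq = integrable_dist_sq_and_e(1)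

lemma integrable_norm_diff_sq:
  assumes [measurable]: "y \<in> borel_measurable P"
    and "integrable P (\<lambda>\<omega>. (norm (y \<omega> - z))\<^sup>2)" "z \<in> Z"
  shows "integrable P (\<lambda>\<omega>. (norm (x n \<omega> - y \<omega>))\<^sup>2)"
proof -
  have "integrable P (\<lambda>\<omega>. 2 * (norm (x n \<omega> - z))\<^sup>2 + 2 * (norm (y \<omega> - z))\<^sup>2)"
    using integrable_dist_sq[OF assms(3)] assms(2) by simp
  then show ?thesis
    by (rule Bochner_Integration.integrable_bound)
      (use norm_diff_sq_le in \<open>auto intro!: AE_I2\<close>)
qed

lemma integrable_infdist_sq: "integrable P (\<lambda>\<omega>. (infdist (x n \<omega>) Z)\<^sup>2)"
proof -
  obtain z where z: "z \<in> Z" using Z_nonempty by blast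
  show ?thesis
    by (rule Bochner_Integration.integrable_bound[OF integrable_dist_sq[OF z, of n]])
      (use infdist_le[OF z] in \<open>auto simp: dist_norm infdist_nonneg intro!: AE_I2 power_mono\<close>)
qed

lemma integrable_indicator_mult:
  fixes f :: "'w \<Rightarrow> real"
  assumes "A \<in> sets (history P x n)" "integrable P f"
  shows "integrable P (\<lambda>\<omega>. indicator A \<omega> * f \<omega>)"
proof -
  have "A \<in> sets P" using assms(1) history_subset[of x P n] x_rv by blast
  from integrable_mult_indicator[OF this assms(2)] show ?thesis by simp
qed

lemma x_in_L2: "x n \<in> Lp 2 P UNIV"
  using Z_nonempty Lp_2_of_diff[OF x_rv integrable_dist_sq] by blast

end

text \<open>The mean inequality on all events of the past is the conditional one, in the form in which
  \<open>integral_le_by_near_selection\<close> applies it to the pieces of a partition.\<close>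

locale stochastic_fejer = pathwise_quasi_fejer P x Z e c
  for P :: "'w measure" and x :: "nat \<Rightarrow> 'w \<Rightarrow> 'a::{real_inner,complete_space,second_countable_topology}"
    and Z :: "'a set" and e :: "nat \<Rightarrow> 'w \<Rightarrow> real" and c :: real +
  fixes \<mu> :: real
  assumes \<mu>_pos: "0 < \<mu>"
    and mean_step: "\<And>n z A. z \<in> Z \<Longrightarrow> A \<in> sets (history P x n) \<Longrightarrow>
      (\<integral>\<omega>. indicator A \<omega> * (norm (x (Suc n) \<omega> - z))\<^sup>2 \<partial>P)
        \<le> (\<integral>\<omega>. indicator A \<omega> * ((norm (x n \<omega> - z))\<^sup>2 - \<mu> * e n \<omega>) \<partial>P)"
begin

lemma mean_dist_le:
  assumes z: "z \<in> Z" and A: "A \<in> sets (history P x n)"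
  shows "(\<integral>\<omega>. indicator A \<omega> * (norm (x (n + j) \<omega> - z))\<^sup>2 \<partial>P)
    \<le> (\<integral>\<omega>. indicator A \<omega> * (norm (x n \<omega> - z))\<^sup>2 \<partial>P)"
proof (induction j)
  case (Suc j)
  have A': "A \<in> sets (history P x (n + j))" using A history_mono[of n "n + j"] by auto
  have "(\<integral>\<omega>. indicator A \<omega> * (norm (x (Suc (n + j)) \<omega> - z))\<^sup>2 \<partial>P)
      \<le> (\<integral>\<omega>. indicator A \<omega> * ((norm (x (n + j) \<omega> - z))\<^sup>2 - \<mu> * e (n + j) \<omega>) \<partial>P)"
    by (rule mean_step[OF z A'])
  also have "\<dots> \<le> (\<integral>\<omega>. indicator A \<omega> * (norm (x (n + j) \<omega> - z))\<^sup>2 \<partial>P)"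
    using \<mu>_pos e_nonneg z
    by (intro integral_mono integrable_indicator_mult[OF A'] mult_left_mono)
      (auto intro!: integrable_dist_sq integrable_e)
  finally show ?case using Suc by simp
qed simp

text \<open>The means of the squared distances to one \<open>z\<close> decrease by at least \<open>\<mu> E e\<^sub>n\<close> in each step and stay nonnegative, so the sum telescopes.\<close>

lemma mean_e_summable: "summable (\<lambda>n. \<integral>\<omega>. e n \<omega> \<partial>P)"
proof -
  obtain z where z: "z \<in> Z" using Z_nonempty by blast
  let ?D = "\<lambda>n. \<integral>\<omega>. (norm (x n \<omega> - z))\<^sup>2 \<partial>P"
  have *: "?D (Suc n) \<le> ?D n - \<mu> * (\<integral>\<omega>. e n \<omega> \<partial>P)" for n
  proof -
    have "space P \<in> sets (history P x n)" by (metis sets.top space_history)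
    from mean_step[OF z this]
    have "(\<integral>\<omega>. indicator (space P) \<omega> * (norm (x (Suc n) \<omega> - z))\<^sup>2 \<partial>P)
        \<le> (\<integral>\<omega>. indicator (space P) \<omega> * ((norm (x n \<omega> - z))\<^sup>2 - \<mu> * e n \<omega>) \<partial>P)" .
    also have "(\<integral>\<omega>. indicator (space P) \<omega> * (norm (x (Suc n) \<omega> - z))\<^sup>2 \<partial>P) = ?D (Suc n)"
      by (intro Bochner_Integration.integral_cong) auto
    also have "(\<integral>\<omega>. indicator (space P) \<omega> * ((norm (x n \<omega> - z))\<^sup>2 - \<mu> * e n \<omega>) \<partial>P)
        = (\<integral>\<omega>. (norm (x n \<omega> - z))\<^sup>2 - \<mu> * e n \<omega> \<partial>P)"
      by (intro Bochner_Integration.integral_cong) auto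
    also have "\<dots> = ?D n - \<mu> * (\<integral>\<omega>. e n \<omega> \<partial>P)"
      using integrable_dist_sq[OF z] integrable_e by simp
    finally show ?thesis .
  qed
  have sum_le: "\<mu> * (\<Sum>i<n. \<integral>\<omega>. e i \<omega> \<partial>P) \<le> ?D 0 - ?D n" for n
  proof (induction n)
    case (Suc n)
    with *[of n] show ?case by (simp add: distrib_left)
  qed simp
  show ?thesis
  proof (rule summableI_nonneg_bounded)
    show "0 \<le> (\<integral>\<omega>. e n \<omega> \<partial>P)" for n by (simp add: e_nonneg)
    show "(\<Sum>i<n. \<integral>\<omega>. e i \<omega> \<partial>P) \<le> ?D 0 / \<mu>" for n
    proof -
      have "0 \<le> ?D n" by simp
      with sum_le[of n] have "\<mu> * (\<Sum>i<n. \<integral>\<omega>. e i \<omega> \<partial>P) \<le> ?D 0" by linarith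
      then show ?thesis using \<mu>_pos by (simp add: pos_le_divide_eq mult.commute)
    qed
  qed
qed

lemma AE_summable_e: "AE \<omega> in P. summable (\<lambda>n. e n \<omega>)"
  and integrable_suminf_e: "integrable P (\<lambda>\<omega>. \<Sum>n. e n \<omega>)"
  using summable_integrals_imp_AE_summable[OF integrable_e e_nonneg mean_e_summable] by auto

text \<open>An integrable majorant of all squared distances to \<open>z\<close> along a trajectory, and of the squared distance of the limit.\<close>

definition envelope :: "'a \<Rightarrow> 'w \<Rightarrow> real" where
  "envelope z \<omega> = (norm (x 0 \<omega> - z))\<^sup>2 + c * (\<Sum>n. e n \<omega>)"

lemma integrable_envelope: "z \<in> Z \<Longrightarrow> integrable P (envelope z)"
  unfolding envelope_def using integrable_dist_sq integrable_suminf_e by simp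

lemma AE_dist_le_envelope:
  assumes "z \<in> Z"
  shows "AE \<omega> in P. \<forall>n. (norm (x n \<omega> - z))\<^sup>2 \<le> envelope z \<omega>"
proof -
  have "AE \<omega> in P. \<forall>n. (norm (x (Suc n) \<omega> - z))\<^sup>2 \<le> (norm (x n \<omega> - z))\<^sup>2 + c * e n \<omega>"
    unfolding AE_all_countable using step[OF assms] by blast
  with AE_summable_e show ?thesis
  proof eventually_elim
    case (elim \<omega>)
    show ?case
    proof
      fix n
      have "(norm (x n \<omega> - z))\<^sup>2 \<le> (norm (x 0 \<omega> - z))\<^sup>2 + c * (\<Sum>i<n. e i \<omega>)"
      proof (induction n)
        case (Suc n)
        with elim(2) have "(norm (x (Suc n) \<omega> - z))\<^sup>2
            \<le> (norm (x 0 \<omega> - z))\<^sup>2 + c * (\<Sum>i<n. e i \<omega>) + c * e n \<omega>"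
          by (smt (verit))
        then show ?case by (simp add: distrib_left)
      qed simp
      also have "c * (\<Sum>i<n. e i \<omega>) \<le> c * (\<Sum>i. e i \<omega>)"
        using elim(1) by (intro mult_left_mono sum_le_suminf c_nonneg) (auto simp: e_nonneg)
      finally show "(norm (x n \<omega> - z))\<^sup>2 \<le> envelope z \<omega>" by (simp add: envelope_def)
    qed
  qed
qed

text \<open>The exceptional null set of the one-step inequality depends on \<open>z\<close>. A countable dense subset of \<open>Z\<close>
  gives one null set for all \<open>z\<close>, because both sides of the inequality are continuous in \<open>z\<close>.\<close>

lemma AE_dist_convergent: "AE \<omega> in P. \<forall>z\<in>Z. convergent (\<lambda>n. norm (x n \<omega> - z))"
proof -
  obtain d :: "nat \<Rightarrow> 'a" where d: "range d \<subseteq> Z" "Z \<subseteq> closure (range d)"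
    using countable_dense_subset[OF Z_nonempty] .
  have "AE \<omega> in P. \<forall>j n. (norm (x (Suc n) \<omega> - d j))\<^sup>2 \<le> (norm (x n \<omega> - d j))\<^sup>2 + c * e n \<omega>"
    unfolding AE_all_countable using step d(1) by blast
  with AE_summable_e show ?thesis
  proof eventually_elim
    case (elim \<omega>)
    show ?case
    proof
      fix z assume "z \<in> Z"
      have all: "(norm (x (Suc n) \<omega> - z))\<^sup>2 \<le> (norm (x n \<omega> - z))\<^sup>2 + c * e n \<omega>" for n
      proof -
        let ?C = "{z. (norm (x (Suc n) \<omega> - z))\<^sup>2 \<le> (norm (x n \<omega> - z))\<^sup>2 + c * e n \<omega>}"
        have "closed ?C" by (intro closed_Collect_le continuous_intros)
        then have "closure (range d) \<subseteq> ?C" using elim(2) by (intro closure_minimal) auto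
        with d(2) \<open>z \<in> Z\<close> show ?thesis by blast
      qed
      have "convergent (\<lambda>n. (norm (x n \<omega> - z))\<^sup>2)"
        using elim(1) all c_nonneg e_nonneg
        by (intro quasi_fejer_convergent[of _ "\<lambda>n. c * e n \<omega>"]) (auto intro: summable_mult)
      then obtain l where "(\<lambda>n. (norm (x n \<omega> - z))\<^sup>2) \<longlonglongrightarrow> l" by (auto simp: convergent_def)
      from tendsto_real_sqrt[OF this] show "convergent (\<lambda>n. norm (x n \<omega> - z))"
        by (auto simp: convergent_def)
    qed
  qed
qed

text \<open>This replaces a measurable projection onto \<open>Z\<close>. The space is split into countably many events of the
  past, on each of which one fixed \<open>z\<close> nearly attains the distance of \<open>x n\<close> to \<open>Z\<close>. An inequality that
  holds on each piece for its own \<open>z\<close>, with an error proportional to \<open>\<epsilon>\<close>, is summed over the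
  pieces before \<open>\<epsilon>\<close> tends to \<open>0\<close>.\<close>

lemma integral_le_by_near_selection:
  fixes f g :: "'w \<Rightarrow> real"
  assumes f: "integrable P f" and g: "integrable P g"
    and le: "\<And>z A \<epsilon>. z \<in> Z \<Longrightarrow> A \<in> sets (history P x n) \<Longrightarrow> 0 < \<epsilon> \<Longrightarrow>
      (\<And>\<omega>. \<omega> \<in> A \<Longrightarrow> (norm (x n \<omega> - z))\<^sup>2 \<le> (infdist (x n \<omega>) Z)\<^sup>2 + \<epsilon>) \<Longrightarrow>
      (\<integral>\<omega>. indicator A \<omega> * f \<omega> \<partial>P) \<le> (\<integral>\<omega>. indicator A \<omega> * (g \<omega> + C * \<epsilon>) \<partial>P)"
    and C: "0 < C"
  shows "(\<integral>\<omega>. f \<omega> \<partial>P) \<le> (\<integral>\<omega>. g \<omega> \<partial>P)"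
proof (rule field_le_epsilon)
  fix \<eta> :: real assume "0 < \<eta>"
  define \<epsilon> where "\<epsilon> = \<eta> / C"
  have \<epsilon>: "0 < \<epsilon>" "C * \<epsilon> = \<eta>" using \<open>0 < \<eta>\<close> C by (auto simp: \<epsilon>_def)
  obtain d :: "nat \<Rightarrow> 'a" where d: "range d \<subseteq> Z" "Z \<subseteq> closure (range d)"
    using countable_dense_subset[OF Z_nonempty] .
  define B where "B j = {\<omega>\<in>space P. (norm (x n \<omega> - d j))\<^sup>2 \<le> (infdist (x n \<omega>) Z)\<^sup>2 + \<epsilon>}" for j
  define A where "A = disjointed B"
  have B: "B j \<in> sets (history P x n)" for j
  proof -
    note [measurable] = measurable_history[of n n x P, simplified]
    have "{\<omega>\<in>space (history P x n). (norm (x n \<omega> - d j))\<^sup>2 \<le> (infdist (x n \<omega>) Z)\<^sup>2 + \<epsilon>}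
        \<in> sets (history P x n)"
      by measurable
    then show ?thesis by (simp add: B_def)
  qed
  then have A: "A j \<in> sets (history P x n)" for j
    using sets.range_disjointed_sets[of B "history P x n"] unfolding A_def by (auto simp: image_subset_iff)
  have "(\<Union>j. B j) = space P"
  proof
    show "space P \<subseteq> (\<Union>j. B j)"
    proof
      fix \<omega> assume "\<omega> \<in> space P"
      moreover obtain j where "(dist (x n \<omega>) (d j))\<^sup>2 \<le> (infdist (x n \<omega>) Z)\<^sup>2 + \<epsilon>"
        using infdist_near_sq[OF Z_nonempty d(2) \<epsilon>(1)] .
      ultimately show "\<omega> \<in> (\<Union>j. B j)" by (auto simp: B_def dist_norm)
    qed
  qed (auto simp: B_def)
  then have A_cover: "(\<Union>j. A j) = space P" by (simp add: A_def UN_disjointed_eq)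
  have "(\<integral>\<omega>. f \<omega> - (g \<omega> + C * \<epsilon>) \<partial>P) \<le> 0"
  proof (rule integral_nonpos_of_countable_cover[where A = A])
    show "A j \<in> sets P" for j using A history_subset[of x P n] x_rv by blast
    show "disjoint_family A" unfolding A_def by (rule disjoint_family_disjointed)
    show "(\<integral>\<omega>. indicator (A j) \<omega> * (f \<omega> - (g \<omega> + C * \<epsilon>)) \<partial>P) \<le> 0" for j
    proof -
      have "(\<integral>\<omega>. indicator (A j) \<omega> * f \<omega> \<partial>P) \<le> (\<integral>\<omega>. indicator (A j) \<omega> * (g \<omega> + C * \<epsilon>) \<partial>P)"
      proof (rule le[OF _ A \<epsilon>(1)])
        show "d j \<in> Z" using d(1) by blast
        fix \<omega> assume "\<omega> \<in> A j"
        then have "\<omega> \<in> B j" by (simp add: A_def disjointed_def)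
        then show "(norm (x n \<omega> - d j))\<^sup>2 \<le> (infdist (x n \<omega>) Z)\<^sup>2 + \<epsilon>" by (simp add: B_def)
      qed
      moreover have "integrable P (\<lambda>\<omega>. indicator (A j) \<omega> * f \<omega>)"
        "integrable P (\<lambda>\<omega>. indicator (A j) \<omega> * (g \<omega> + C * \<epsilon>))"
        using f g by (auto intro!: integrable_indicator_mult[OF A])
      ultimately show ?thesis by (simp add: right_diff_distrib)
    qed
  qed (use f g A_cover in auto)
  then show "(\<integral>\<omega>. f \<omega> \<partial>P) \<le> (\<integral>\<omega>. g \<omega> \<partial>P) + \<eta>"
    using f g \<epsilon> by (simp add: prob_space)
qed

text \<open>On each piece the new distance to \<open>Z\<close> is at most the distance to the selected \<open>z\<close>, to which the mean inequality applies.\<close>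

lemma mean_infdist_step:
  "(\<integral>\<omega>. (infdist (x (Suc n) \<omega>) Z)\<^sup>2 \<partial>P) \<le> (\<integral>\<omega>. (infdist (x n \<omega>) Z)\<^sup>2 \<partial>P) - \<mu> * (\<integral>\<omega>. e n \<omega> \<partial>P)"
proof -
  have "(\<integral>\<omega>. (infdist (x (Suc n) \<omega>) Z)\<^sup>2 \<partial>P) \<le> (\<integral>\<omega>. (infdist (x n \<omega>) Z)\<^sup>2 - \<mu> * e n \<omega> \<partial>P)"
  proof (rule integral_le_by_near_selection[where C = 1 and n = n])
    fix z A and \<epsilon> :: real
    assume z: "z \<in> Z" and A: "A \<in> sets (history P x n)" and "0 < \<epsilon>"
      and near: "\<And>\<omega>. \<omega> \<in> A \<Longrightarrow> (norm (x n \<omega> - z))\<^sup>2 \<le> (infdist (x n \<omega>) Z)\<^sup>2 + \<epsilon>"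
    have "(\<integral>\<omega>. indicator A \<omega> * (infdist (x (Suc n) \<omega>) Z)\<^sup>2 \<partial>P)
        \<le> (\<integral>\<omega>. indicator A \<omega> * (norm (x (Suc n) \<omega> - z))\<^sup>2 \<partial>P)"
      using z infdist_le[OF z] infdist_nonneg
      by (intro integral_mono integrable_indicator_mult[OF A] mult_left_mono power_mono)
        (auto intro!: integrable_dist_sq integrable_infdist_sq simp: dist_norm)
    also have "\<dots> \<le> (\<integral>\<omega>. indicator A \<omega> * ((norm (x n \<omega> - z))\<^sup>2 - \<mu> * e n \<omega>) \<partial>P)"
      by (rule mean_step[OF z A])
    also have "\<dots> \<le> (\<integral>\<omega>. indicator A \<omega> * ((infdist (x n \<omega>) Z)\<^sup>2 - \<mu> * e n \<omega> + 1 * \<epsilon>) \<partial>P)"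
    proof (rule integral_mono)
      show "indicator A \<omega> * ((norm (x n \<omega> - z))\<^sup>2 - \<mu> * e n \<omega>)
          \<le> indicator A \<omega> * ((infdist (x n \<omega>) Z)\<^sup>2 - \<mu> * e n \<omega> + 1 * \<epsilon>)" for \<omega>
        using near[of \<omega>] by (auto simp: indicator_def)
    qed (intro integrable_indicator_mult[OF A] Bochner_Integration.integrable_add
      Bochner_Integration.integrable_diff integrable_dist_sq integrable_infdist_sq
      integrable_mult_right integrable_e z integrable_const)+
    finally show "(\<integral>\<omega>. indicator A \<omega> * (infdist (x (Suc n) \<omega>) Z)\<^sup>2 \<partial>P)
        \<le> (\<integral>\<omega>. indicator A \<omega> * ((infdist (x n \<omega>) Z)\<^sup>2 - \<mu> * e n \<omega> + 1 * \<epsilon>) \<partial>P)" .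
  qed (use integrable_infdist_sq integrable_e in auto)
  then show ?thesis using integrable_infdist_sq integrable_e by simp
qed

text \<open>Both \<open>x (n + j)\<close> and \<open>x n\<close> are in mean at most as far from the selected \<open>z\<close> as \<open>x n\<close>, and the triangle
  inequality through \<open>z\<close> costs a factor \<open>4\<close> on the squares.\<close>

lemma mean_increment_le:
  "(\<integral>\<omega>. (norm (x (n + j) \<omega> - x n \<omega>))\<^sup>2 \<partial>P) \<le> 4 * (\<integral>\<omega>. (infdist (x n \<omega>) Z)\<^sup>2 \<partial>P)"
proof -
  obtain z0 where z0: "z0 \<in> Z" using Z_nonempty by blast
  have int: "integrable P (\<lambda>\<omega>. (norm (x (n + j) \<omega> - x n \<omega>))\<^sup>2)"
    by (rule integrable_norm_diff_sq[OF x_rv integrable_dist_sq[OF z0] z0])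
  have "(\<integral>\<omega>. (norm (x (n + j) \<omega> - x n \<omega>))\<^sup>2 \<partial>P) \<le> (\<integral>\<omega>. 4 * (infdist (x n \<omega>) Z)\<^sup>2 \<partial>P)"
  proof (rule integral_le_by_near_selection[where C = 4 and n = n])
    fix z A and \<epsilon> :: real
    assume z: "z \<in> Z" and A: "A \<in> sets (history P x n)" and "0 < \<epsilon>"
      and near: "\<And>\<omega>. \<omega> \<in> A \<Longrightarrow> (norm (x n \<omega> - z))\<^sup>2 \<le> (infdist (x n \<omega>) Z)\<^sup>2 + \<epsilon>"
    let ?I = "\<lambda>j. \<integral>\<omega>. indicator A \<omega> * (norm (x j \<omega> - z))\<^sup>2 \<partial>P"
    have int': "integrable P (\<lambda>\<omega>. indicator A \<omega> * (norm (x j \<omega> - z))\<^sup>2)" for j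
      by (intro integrable_indicator_mult[OF A] integrable_dist_sq z)
    have "(\<integral>\<omega>. indicator A \<omega> * (norm (x (n + j) \<omega> - x n \<omega>))\<^sup>2 \<partial>P)
        \<le> (\<integral>\<omega>. 2 * (indicator A \<omega> * (norm (x (n + j) \<omega> - z))\<^sup>2)
            + 2 * (indicator A \<omega> * (norm (x n \<omega> - z))\<^sup>2) \<partial>P)"
    proof (rule integral_mono)
      show "integrable P (\<lambda>\<omega>. indicator A \<omega> * (norm (x (n + j) \<omega> - x n \<omega>))\<^sup>2)"
        by (intro integrable_indicator_mult[OF A] int)
      show "indicator A \<omega> * (norm (x (n + j) \<omega> - x n \<omega>))\<^sup>2
          \<le> 2 * (indicator A \<omega> * (norm (x (n + j) \<omega> - z))\<^sup>2)
            + 2 * (indicator A \<omega> * (norm (x n \<omega> - z))\<^sup>2)" for \<omega>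
        using norm_diff_sq_le[of "x (n + j) \<omega>" "x n \<omega>" z] by (auto simp: indicator_def)
    qed (use int' in simp)
    also have "\<dots> = 2 * ?I (n + j) + 2 * ?I n"
      using int' by simp
    also have "\<dots> \<le> (\<integral>\<omega>. 4 * (indicator A \<omega> * (norm (x n \<omega> - z))\<^sup>2) \<partial>P)"
      using mean_dist_le[OF z A, of j] by simp
    also have "\<dots> \<le> (\<integral>\<omega>. indicator A \<omega> * (4 * (infdist (x n \<omega>) Z)\<^sup>2 + 4 * \<epsilon>) \<partial>P)"
    proof (rule integral_mono)
      show "4 * (indicator A \<omega> * (norm (x n \<omega> - z))\<^sup>2)
          \<le> indicator A \<omega> * (4 * (infdist (x n \<omega>) Z)\<^sup>2 + 4 * \<epsilon>)" for \<omega>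
        using near[of \<omega>] by (auto simp: indicator_def)
      show "integrable P (\<lambda>\<omega>. indicator A \<omega> * (4 * (infdist (x n \<omega>) Z)\<^sup>2 + 4 * \<epsilon>))"
        by (intro integrable_indicator_mult[OF A]) (use integrable_infdist_sq in simp)
    qed (use int' in simp)
    finally show "(\<integral>\<omega>. indicator A \<omega> * (norm (x (n + j) \<omega> - x n \<omega>))\<^sup>2 \<partial>P)
        \<le> (\<integral>\<omega>. indicator A \<omega> * (4 * (infdist (x n \<omega>) Z)\<^sup>2 + 4 * \<epsilon>) \<partial>P)" .
  qed (use integrable_infdist_sq int in auto)
  then show ?thesis by simp
qed

text \<open>Opial gives a limit outside a null set; any measurable value can be assigned on that null set.\<close>

lemma weak_limit_exists:
  assumes cluster: "AE \<omega> in P. \<forall>r y. strict_mono r \<longrightarrow> weakly_converges ((\<lambda>n. x n \<omega>) \<circ> r) y \<longrightarrow> y \<in> Z"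
  obtains y where "y \<in> borel_measurable P" "AE \<omega> in P. y \<omega> \<in> Z"
    "AE \<omega> in P. weakly_converges (\<lambda>n. x n \<omega>) (y \<omega>)"
proof -
  obtain z where z: "z \<in> Z" using Z_nonempty by blast
  have "AE \<omega> in P. \<exists>y\<in>Z. weakly_converges (\<lambda>n. x n \<omega>) y"
    using cluster AE_dist_convergent
  proof eventually_elim
    case (elim \<omega>)
    obtain y where "y \<in> Z" "weakly_converges (\<lambda>n. x n \<omega>) y"
      by (rule opial_weak_convergence[OF Z_nonempty, of "\<lambda>n. x n \<omega>"]) (use elim in auto)
    then show ?case by blast
  qed
  then obtain N where N: "N \<in> null_sets P"
    "\<And>\<omega>. \<omega> \<in> space P - N \<Longrightarrow> \<exists>y\<in>Z. weakly_converges (\<lambda>n. x n \<omega>) y"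
    by (elim AE_E3) blast
  have [measurable]: "N \<in> sets P" using N(1) by blast
  define y where "y \<omega> = (if \<omega> \<in> N then z else SOME y. y \<in> Z \<and> weakly_converges (\<lambda>n. x n \<omega>) y)" for \<omega>
  have y: "y \<omega> \<in> Z \<and> weakly_converges (\<lambda>n. x n \<omega>) (y \<omega>)" if "\<omega> \<in> space P - N" for \<omega>
  proof -
    from N(2)[OF that] have "\<exists>y. y \<in> Z \<and> weakly_converges (\<lambda>n. x n \<omega>) y" by blast
    from someI_ex[OF this] show ?thesis using that by (simp add: y_def)
  qed
  have "y \<in> borel_measurable P"
  proof (rule borel_measurable_weakI)
    fix u
    have lim: "(\<lambda>n. if \<omega> \<in> N then inner z u else inner (x n \<omega>) u) \<longlonglongrightarrow> inner (y \<omega>) u"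
      if "\<omega> \<in> space P" for \<omega>
      using y[of \<omega>] that by (cases "\<omega> \<in> N") (simp_all add: y_def weakly_converges_def)
    show "(\<lambda>\<omega>. inner (y \<omega>) u) \<in> borel_measurable P"
      by (rule borel_measurable_LIMSEQ_real[OF lim]) measurable
  qed
  moreover have "AE \<omega> in P. \<omega> \<notin> N" using N(1) by (rule AE_not_in)
  then have "AE \<omega> in P. y \<omega> \<in> Z" "AE \<omega> in P. weakly_converges (\<lambda>n. x n \<omega>) (y \<omega>)"
    using AE_space by (eventually_elim, use y in blast)+
  ultimately show ?thesis by (rule that)
qed

end

locale weakly_convergent_stochastic_fejer = stochastic_fejer P x Z e c \<mu>
  for P :: "'w measure" and x :: "nat \<Rightarrow> 'w \<Rightarrow> 'a::{real_inner,complete_space,second_countable_topology}"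
    and Z :: "'a set" and e :: "nat \<Rightarrow> 'w \<Rightarrow> real" and c :: real and \<mu> :: real +
  fixes y :: "'w \<Rightarrow> 'a"
  assumes y_rv [measurable]: "y \<in> borel_measurable P"
    and y_weak: "AE \<omega> in P. weakly_converges (\<lambda>n. x n \<omega>) (y \<omega>)"
begin

text \<open>The norm is weakly lower semicontinuous.\<close>

lemma AE_limit_dist_le_envelope:
  assumes z: "z \<in> Z"
  shows "AE \<omega> in P. (norm (y \<omega> - z))\<^sup>2 \<le> envelope z \<omega>"
  using AE_dist_le_envelope[OF z] y_weak
proof eventually_elim
  case (elim \<omega>)
  have "weakly_converges (\<lambda>n. x n \<omega> - z) (y \<omega> - z)"
    using elim(2) unfolding weakly_converges_def inner_diff_left by (intro allI tendsto_diff tendsto_const) auto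
  moreover have "norm (x n \<omega> - z) \<le> sqrt (envelope z \<omega>)" for n
    using elim(1) by (intro real_le_rsqrt) auto
  ultimately have "norm (y \<omega> - z) \<le> sqrt (envelope z \<omega>)" by (rule weakly_converges_norm_le)
  moreover have "0 \<le> envelope z \<omega>" using elim(1) zero_le_power2 order_trans by blast
  ultimately show ?case using power_mono[of "norm (y \<omega> - z)" "sqrt (envelope z \<omega>)" 2] by simp
qed

lemma integrable_limit_dist_sq:
  assumes "z \<in> Z"
  shows "integrable P (\<lambda>\<omega>. (norm (y \<omega> - z))\<^sup>2)"
proof (rule Bochner_Integration.integrable_bound[OF integrable_envelope[OF assms]])
  show "AE \<omega> in P. norm ((norm (y \<omega> - z))\<^sup>2) \<le> norm (envelope z \<omega>)"
    using AE_limit_dist_le_envelope[OF assms] by eventually_elim auto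
qed measurable

lemma integrable_limit_diff_sq: "integrable P (\<lambda>\<omega>. (norm (x n \<omega> - y \<omega>))\<^sup>2)"
  using Z_nonempty integrable_norm_diff_sq[OF y_rv integrable_limit_dist_sq] by blast

lemma limit_in_L2: "y \<in> Lp 2 P UNIV"
  using Z_nonempty Lp_2_of_diff[OF y_rv integrable_limit_dist_sq] by blast

lemma weakly_convergent_in_L2: "L2_weakly_converges P x y"
  unfolding L2_weakly_converges_def
proof (intro conjI allI ballI x_in_L2 limit_in_L2)
  fix u :: "'w \<Rightarrow> 'a" assume "u \<in> Lp 2 P UNIV"
  then have [measurable]: "u \<in> borel_measurable P" and u: "integrable P (\<lambda>\<omega>. (norm (u \<omega>))\<^sup>2)"
    by (auto simp: Lp_def)
  obtain z where z: "z \<in> Z" using Z_nonempty by blast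
  show "(\<lambda>n. \<integral>\<omega>. inner (x n \<omega>) (u \<omega>) \<partial>P) \<longlonglongrightarrow> (\<integral>\<omega>. inner (y \<omega>) (u \<omega>) \<partial>P)"
  proof (rule integral_dominated_convergence)
    show "integrable P (\<lambda>\<omega>. 2 * envelope z \<omega> + 2 * (norm z)\<^sup>2 + (norm (u \<omega>))\<^sup>2)"
      using integrable_envelope[OF z] u by simp
    show "AE \<omega> in P. (\<lambda>n. inner (x n \<omega>) (u \<omega>)) \<longlonglongrightarrow> inner (y \<omega>) (u \<omega>)"
      using y_weak by eventually_elim (auto simp: weakly_converges_def)
    show "AE \<omega> in P. norm (inner (x n \<omega>) (u \<omega>)) \<le> 2 * envelope z \<omega> + 2 * (norm z)\<^sup>2 + (norm (u \<omega>))\<^sup>2" for n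
      using AE_dist_le_envelope[OF z]
    proof eventually_elim
      case (elim \<omega>)
      have "(norm (x n \<omega>))\<^sup>2 \<le> 2 * (norm (x n \<omega> - z))\<^sup>2 + 2 * (norm z)\<^sup>2"
        using norm_diff_sq_le[of "x n \<omega>" 0 z] by simp
      then show ?case
        using abs_inner_le_half_sum_sq[of "x n \<omega>" "u \<omega>"] elim[rule_format, of n] by simp
    qed
  qed measurable
qed

lemma L1_convergent:
  assumes strong: "AE \<omega> in P. (\<lambda>n. x n \<omega>) \<longlonglongrightarrow> y \<omega>"
  shows "Lp_converges 1 P x y"
proof -
  obtain z where z: "z \<in> Z" using Z_nonempty by blast
  have "(\<lambda>n. \<integral>\<omega>. norm (x n \<omega> - y \<omega>) \<partial>P) \<longlonglongrightarrow> (\<integral>\<omega>. 0 \<partial>P)"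
  proof (rule integral_dominated_convergence)
    show "integrable P (\<lambda>\<omega>. 1 + 4 * envelope z \<omega>)" using integrable_envelope[OF z] by simp
    show "AE \<omega> in P. (\<lambda>n. norm (x n \<omega> - y \<omega>)) \<longlonglongrightarrow> 0"
      using strong by eventually_elim (simp add: tendsto_norm_zero_iff LIM_zero_iff)
    show "AE \<omega> in P. norm (norm (x n \<omega> - y \<omega>)) \<le> 1 + 4 * envelope z \<omega>" for n
      using AE_dist_le_envelope[OF z] AE_limit_dist_le_envelope[OF z]
    proof eventually_elim
      case (elim \<omega>)
      show ?case
        using le_one_add_sq[of "norm (x n \<omega> - y \<omega>)"] norm_diff_sq_le[of "x n \<omega>" "y \<omega>" z] elim(1)[rule_format, of n] elim(2) by simp
    qed
  qed measurable
  then show ?thesis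
    using Lp_2_imp_Lp_1[OF x_in_L2] Lp_2_imp_Lp_1[OF limit_in_L2]
    by (simp add: Lp_converges_def)
qed

text \<open>With \<open>u = y - x\<^sub>n\<close>, weak convergence in \<open>L\<^sup>2\<close> gives \<open>E \<langle>x\<^sub>n\<^sub>+\<^sub>m - x\<^sub>n, u\<rangle> \<rightarrow> E \<parallel>u\<parallel>\<^sup>2\<close>. The left-hand side is at most
  \<open>E \<parallel>x\<^sub>n\<^sub>+\<^sub>m - x\<^sub>n\<parallel>\<^sup>2 / 2 + E \<parallel>u\<parallel>\<^sup>2 / 2\<close>, and the first term is controlled uniformly in \<open>m\<close> by
  \<open>mean_increment_le\<close>. So the bound on increments passes to the limit.\<close>

lemma mean_limit_dist_le:
  "(\<integral>\<omega>. (norm (x n \<omega> - y \<omega>))\<^sup>2 \<partial>P) \<le> 4 * (\<integral>\<omega>. (infdist (x n \<omega>) Z)\<^sup>2 \<partial>P)"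
proof -
  obtain z where z: "z \<in> Z" using Z_nonempty by blast
  let ?R = "\<integral>\<omega>. (norm (x n \<omega> - y \<omega>))\<^sup>2 \<partial>P" and ?D = "\<integral>\<omega>. (infdist (x n \<omega>) Z)\<^sup>2 \<partial>P"
  define u where "u \<omega> = y \<omega> - x n \<omega>" for \<omega>
  have [measurable]: "u \<in> borel_measurable P" unfolding u_def by measurable
  have u_sq: "integrable P (\<lambda>\<omega>. (norm (u \<omega>))\<^sup>2)"
    using integrable_limit_diff_sq[of n] by (simp add: u_def norm_minus_commute)
  have R: "(\<integral>\<omega>. (norm (u \<omega>))\<^sup>2 \<partial>P) = ?R" by (simp add: u_def norm_minus_commute)
  have u: "u \<in> Lp 2 P UNIV" using u_sq by (simp add: Lp_def)
  have int_inner: "integrable P (\<lambda>\<omega>. inner (v \<omega>) (u \<omega>))" if "v \<in> Lp 2 P UNIV" for v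
  proof (rule Bochner_Integration.integrable_bound)
    show "integrable P (\<lambda>\<omega>. (norm (v \<omega>))\<^sup>2 + (norm (u \<omega>))\<^sup>2)"
      using u_sq that by (simp add: Lp_def)
    show "AE \<omega> in P. norm (inner (v \<omega>) (u \<omega>)) \<le> norm ((norm (v \<omega>))\<^sup>2 + (norm (u \<omega>))\<^sup>2)"
    proof (rule AE_I2)
      fix \<omega>
      have "0 \<le> (norm (v \<omega>))\<^sup>2" "0 \<le> (norm (u \<omega>))\<^sup>2" by auto
      with abs_inner_le_half_sum_sq[of "v \<omega>" "u \<omega>"]
      show "norm (inner (v \<omega>) (u \<omega>)) \<le> norm ((norm (v \<omega>))\<^sup>2 + (norm (u \<omega>))\<^sup>2)"
        by simp
    qed
    show "(\<lambda>\<omega>. inner (v \<omega>) (u \<omega>)) \<in> borel_measurable P"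
      using that by (auto simp: Lp_def intro!: borel_measurable_inner)
  qed
  note int = int_inner[OF x_in_L2] int_inner[OF limit_in_L2]
  have "(\<lambda>m. \<integral>\<omega>. inner (x m \<omega>) (u \<omega>) \<partial>P) \<longlonglongrightarrow> (\<integral>\<omega>. inner (y \<omega>) (u \<omega>) \<partial>P)"
    using weakly_convergent_in_L2 u by (simp add: L2_weakly_converges_def)
  from LIMSEQ_ignore_initial_segment[OF this, of n]
  have "(\<lambda>m. \<integral>\<omega>. inner (x (n + m) \<omega>) (u \<omega>) \<partial>P) \<longlonglongrightarrow> (\<integral>\<omega>. inner (y \<omega>) (u \<omega>) \<partial>P)"
    by (simp add: add.commute)
  from tendsto_diff[OF this tendsto_const]
  have "(\<lambda>m. (\<integral>\<omega>. inner (x (n + m) \<omega>) (u \<omega>) \<partial>P) - (\<integral>\<omega>. inner (x n \<omega>) (u \<omega>) \<partial>P))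
      \<longlonglongrightarrow> (\<integral>\<omega>. inner (y \<omega>) (u \<omega>) \<partial>P) - (\<integral>\<omega>. inner (x n \<omega>) (u \<omega>) \<partial>P)" .
  also have "(\<integral>\<omega>. inner (y \<omega>) (u \<omega>) \<partial>P) - (\<integral>\<omega>. inner (x n \<omega>) (u \<omega>) \<partial>P)
      = (\<integral>\<omega>. inner (y \<omega>) (u \<omega>) - inner (x n \<omega>) (u \<omega>) \<partial>P)"
    by (rule Bochner_Integration.integral_diff[symmetric, OF int(2,1)])
  also have "\<dots> = (\<integral>\<omega>. (norm (u \<omega>))\<^sup>2 \<partial>P)"
    by (simp only: power2_norm_eq_inner inner_diff_left[symmetric] u_def[symmetric])
  also have "\<dots> = ?R" by (rule R)
  finally have "(\<lambda>m. (\<integral>\<omega>. inner (x (n + m) \<omega>) (u \<omega>) \<partial>P) - (\<integral>\<omega>. inner (x n \<omega>) (u \<omega>) \<partial>P))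
      \<longlonglongrightarrow> ?R" .
  moreover have "(\<integral>\<omega>. inner (x (n + m) \<omega>) (u \<omega>) \<partial>P) - (\<integral>\<omega>. inner (x n \<omega>) (u \<omega>) \<partial>P)
      \<le> 2 * ?D + ?R / 2" for m
  proof -
    have inc: "integrable P (\<lambda>\<omega>. (norm (x (n + m) \<omega> - x n \<omega>))\<^sup>2)"
      by (rule integrable_norm_diff_sq[OF x_rv integrable_dist_sq[OF z] z])
    have "(\<integral>\<omega>. inner (x (n + m) \<omega>) (u \<omega>) \<partial>P) - (\<integral>\<omega>. inner (x n \<omega>) (u \<omega>) \<partial>P)
        = (\<integral>\<omega>. inner (x (n + m) \<omega>) (u \<omega>) - inner (x n \<omega>) (u \<omega>) \<partial>P)"
      using int by simp
    also have "\<dots> \<le> (\<integral>\<omega>. (norm (x (n + m) \<omega> - x n \<omega>))\<^sup>2 / 2 + (norm (u \<omega>))\<^sup>2 / 2 \<partial>P)"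
    proof (rule integral_mono)
      show "inner (x (n + m) \<omega>) (u \<omega>) - inner (x n \<omega>) (u \<omega>)
          \<le> (norm (x (n + m) \<omega> - x n \<omega>))\<^sup>2 / 2 + (norm (u \<omega>))\<^sup>2 / 2" for \<omega>
      proof -
        show ?thesis
          using abs_inner_le_half_sum_sq[of "x (n + m) \<omega> - x n \<omega>" "u \<omega>"]
          by (simp add: inner_diff_left)
      qed
    qed (use int inc u_sq in auto)
    also have "\<dots> = (\<integral>\<omega>. (norm (x (n + m) \<omega> - x n \<omega>))\<^sup>2 \<partial>P) / 2 + ?R / 2"
      using inc u_sq by (simp add: R)
    also have "\<dots> \<le> 2 * ?D + ?R / 2" using mean_increment_le[of n m] by simp
    finally show ?thesis .
  qed
  ultimately have "?R \<le> 2 * ?D + ?R / 2" by (intro LIMSEQ_le_const2) auto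
  then show ?thesis by simp
qed

text \<open>A geometric bound on \<open>E \<parallel>x\<^sub>n - y\<parallel>\<^sup>2\<close> is summable, so that \<open>\<parallel>x\<^sub>n - y\<parallel>\<^sup>2\<close> is almost surely summable and in
  particular tends to \<open>0\<close>.\<close>

lemma linear_convergence:
  assumes rate: "\<And>n. (\<integral>\<omega>. (infdist (x (Suc n) \<omega>) Z)\<^sup>2 \<partial>P) \<le> \<theta> * (\<integral>\<omega>. (infdist (x n \<omega>) Z)\<^sup>2 \<partial>P)"
    and \<theta>: "0 \<le> \<theta>" "\<theta> < 1"
  shows "(\<integral>\<omega>. (norm (x n \<omega> - y \<omega>))\<^sup>2 \<partial>P) \<le> 4 * \<theta> ^ n * (\<integral>\<omega>. (infdist (x 0 \<omega>) Z)\<^sup>2 \<partial>P)"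
    and "Lp_converges 2 P x y" and "AE \<omega> in P. (\<lambda>n. x n \<omega>) \<longlonglongrightarrow> y \<omega>"
proof -
  let ?R = "\<lambda>n. \<integral>\<omega>. (norm (x n \<omega> - y \<omega>))\<^sup>2 \<partial>P" and ?D = "\<lambda>n. \<integral>\<omega>. (infdist (x n \<omega>) Z)\<^sup>2 \<partial>P"
  have le: "?R n \<le> 4 * \<theta> ^ n * ?D 0" for n
    using mean_limit_dist_le[of n] linear_recursion_bound[of ?D \<theta> n] rate \<theta>(1) by simp
  then show "?R n \<le> 4 * \<theta> ^ n * ?D 0" .
  have "summable (\<lambda>n. 4 * \<theta> ^ n * ?D 0)"
    using \<theta> by (intro summable_mult2 summable_mult summable_geometric) simp
  then have summ: "summable ?R"
    by (rule summable_comparison_test') (use le in \<open>auto simp: integral_nonneg_AE\<close>)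
  have "(\<lambda>n. root 2 (?R n)) \<longlonglongrightarrow> root 2 0"
    by (intro tendsto_real_root summable_LIMSEQ_zero summ)
  then show "Lp_converges 2 P x y"
    by (simp add: Lp_converges_def x_in_L2 limit_in_L2)
  have "AE \<omega> in P. summable (\<lambda>n. (norm (x n \<omega> - y \<omega>))\<^sup>2)"
    by (rule summable_integrals_imp_AE_summable(1)[OF integrable_limit_diff_sq _ summ]) simp
  then show "AE \<omega> in P. (\<lambda>n. x n \<omega>) \<longlonglongrightarrow> y \<omega>"
  proof eventually_elim
    case (elim \<omega>)
    have "(\<lambda>n. sqrt ((norm (x n \<omega> - y \<omega>))\<^sup>2)) \<longlonglongrightarrow> sqrt 0"
      by (intro tendsto_real_sqrt summable_LIMSEQ_zero elim)
    then show ?case by (simp add: tendsto_norm_zero_iff LIM_zero_iff)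
  qed
qed

end

section \<open>Random firmly quasinonexpansive operators\<close>

locale random_firm_operator = prob_space P for P :: "'w measure" +
  fixes K :: "'k measure"
    and T :: "'k \<Rightarrow> 'a::{real_inner,complete_space,second_countable_topology} \<Rightarrow> 'a"
    and k :: "'w \<Rightarrow> 'k"
  assumes T_fqn: "\<And>c. c \<in> space K \<Longrightarrow> firmly_quasinonexpansive (T c)"
    and T_meas [measurable]: "(\<lambda>(c, y). T c y) \<in> measurable (K \<Otimes>\<^sub>M borel) borel"
    and k_rv [measurable]: "k \<in> measurable P K"
begin

definition common_fix :: "'a set" where
  "common_fix = {z. AE \<omega> in P. z \<in> Fix (T (k \<omega>))}"

definition residual :: "'a \<Rightarrow> real" where
  "residual y = (\<integral>\<omega>. (norm (T (k \<omega>) y - y))\<^sup>2 \<partial>P)"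

lemma T_measurable [measurable (raw)]:
  assumes "f \<in> measurable M K" "g \<in> borel_measurable M"
  shows "(\<lambda>\<omega>. T (f \<omega>) (g \<omega>)) \<in> borel_measurable M"
  using measurable_compose[OF measurable_Pair[OF assms] T_meas] by simp

lemma copy_distr_eq:
  assumes "is_copy P K k \<kappa>"
  shows "distr P K \<kappa> = distr P K k"
proof (rule measure_eqI)
  have [measurable]: "\<kappa> \<in> measurable P K" using assms by (simp add: is_copy_def)
  fix S assume "S \<in> sets (distr P K \<kappa>)"
  then have "S \<in> sets K" by simp
  with assms show "emeasure (distr P K \<kappa>) S = emeasure (distr P K k) S"
    by (simp add: emeasure_distr is_copy_def emeasure_eq_measure)
qed simp

text \<open>Being fixed by \<open>T c\<close> is a measurable property of \<open>c\<close>, so it transfers between random variables with equal distribution.\<close>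

lemma AE_fix_copy:
  assumes copy: "is_copy P K k \<kappa>" and z: "z \<in> common_fix"
  shows "AE \<omega> in P. z \<in> Fix (T (\<kappa> \<omega>))"
proof -
  have [measurable]: "\<kappa> \<in> measurable P K" using copy by (simp add: is_copy_def)
  have *: "(AE \<omega> in P. z \<in> Fix (T (f \<omega>))) \<longleftrightarrow> (AE c in distr P K f. norm (T c z - z) = 0)"
    if [measurable]: "f \<in> measurable P K" for f
    by (subst AE_distr_iff) (auto simp: Fix_def)
  show ?thesis
    using z unfolding common_fix_def mem_Collect_eq *[OF k_rv] *[OF \<open>\<kappa> \<in> measurable P K\<close>]
      copy_distr_eq[OF copy] .
qed

lemma residual_integrable:
  assumes "z \<in> common_fix"
  shows "integrable P (\<lambda>\<omega>. (norm (T (k \<omega>) y - y))\<^sup>2)"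
proof (rule integrable_const_bound)
  have "AE \<omega> in P. z \<in> Fix (T (k \<omega>))" using assms by (simp add: common_fix_def)
  with AE_space show "AE \<omega> in P. norm ((norm (T (k \<omega>) y - y))\<^sup>2) \<le> (norm (y - z))\<^sup>2"
  proof eventually_elim
    case (elim \<omega>)
    from fqn_residual_le[OF T_fqn[OF measurable_space[OF k_rv elim(1)]] elim(2)]
    show ?case by simp
  qed
qed measurable

lemma residual_nonneg: "0 \<le> residual y"
  by (simp add: residual_def)

lemma residual_measurable [measurable]: "residual \<in> borel_measurable borel"
  unfolding residual_def by measurable

text \<open>By independence and equality of distributions, \<open>(\<kappa>, Y)\<close> is distributed according to the product of the laws of
  \<open>k\<close> and \<open>Y\<close>, and integrating out the first coordinate produces the residual at \<open>Y\<close>.\<close>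

lemma mean_residual_copy:
  assumes copy: "is_copy P K k \<kappa>" and Y [measurable]: "Y \<in> borel_measurable P"
    and indep: "indep_set (sigma_rv P K \<kappa>) B" and sub: "sigma_rv P borel Y \<subseteq> B"
    and z: "z \<in> common_fix"
    and int: "integrable P (\<lambda>\<omega>. (norm (T (\<kappa> \<omega>) (Y \<omega>) - Y \<omega>))\<^sup>2)"
  shows "integrable P (\<lambda>\<omega>. residual (Y \<omega>))"
    and "(\<integral>\<omega>. residual (Y \<omega>) \<partial>P) = (\<integral>\<omega>. (norm (T (\<kappa> \<omega>) (Y \<omega>) - Y \<omega>))\<^sup>2 \<partial>P)"
proof -
  have \<kappa> [measurable]: "\<kappa> \<in> measurable P K" using copy by (simp add: is_copy_def)
  let ?g = "\<lambda>(c, y). ennreal ((norm (T c y - y))\<^sup>2)"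
  have g [measurable]: "?g \<in> borel_measurable (K \<Otimes>\<^sub>M borel)" by measurable
  interpret Dk: prob_space "distr P K k" by (rule prob_space_distr) measurable
  interpret DY: prob_space "distr P borel Y" by (rule prob_space_distr) measurable
  interpret pair_sigma_finite "distr P K k" "distr P borel Y" ..
  have joint: "distr P K k \<Otimes>\<^sub>M distr P borel Y = distr P (K \<Otimes>\<^sub>M borel) (\<lambda>\<omega>. (\<kappa> \<omega>, Y \<omega>))"
    using joint_distr_of_indep_set[OF \<kappa> Y indep sub] unfolding copy_distr_eq[OF copy] .
  have "(\<integral>\<^sup>+\<omega>. ennreal ((norm (T (\<kappa> \<omega>) (Y \<omega>) - Y \<omega>))\<^sup>2) \<partial>P)
      = (\<integral>\<^sup>+u. ?g u \<partial>(distr P K k \<Otimes>\<^sub>M distr P borel Y))"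
    unfolding joint by (subst nn_integral_distr) auto
  also have "\<dots> = (\<integral>\<^sup>+y. (\<integral>\<^sup>+c. ?g (c, y) \<partial>distr P K k) \<partial>distr P borel Y)"
    by (rule nn_integral_snd[symmetric]) measurable
  also have "\<dots> = (\<integral>\<^sup>+\<omega>. (\<integral>\<^sup>+\<omega>'. ennreal ((norm (T (k \<omega>') (Y \<omega>) - Y \<omega>))\<^sup>2) \<partial>P) \<partial>P)"
    by (simp add: nn_integral_distr)
  also have "\<dots> = (\<integral>\<^sup>+\<omega>. ennreal (residual (Y \<omega>)) \<partial>P)"
    unfolding residual_def
    by (intro nn_integral_cong nn_integral_eq_integral residual_integrable[OF z] AE_I2) simp
  finally have eq: "(\<integral>\<^sup>+\<omega>. ennreal (residual (Y \<omega>)) \<partial>P)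
      = (\<integral>\<^sup>+\<omega>. ennreal ((norm (T (\<kappa> \<omega>) (Y \<omega>) - Y \<omega>))\<^sup>2) \<partial>P)" by simp
  also have "\<dots> = ennreal (\<integral>\<omega>. (norm (T (\<kappa> \<omega>) (Y \<omega>) - Y \<omega>))\<^sup>2 \<partial>P)"
    by (intro nn_integral_eq_integral int AE_I2) simp
  finally have fin: "(\<integral>\<^sup>+\<omega>. ennreal (residual (Y \<omega>)) \<partial>P)
      = ennreal (\<integral>\<omega>. (norm (T (\<kappa> \<omega>) (Y \<omega>) - Y \<omega>))\<^sup>2 \<partial>P)" .
  then show *: "integrable P (\<lambda>\<omega>. residual (Y \<omega>))"
    by (intro integrableI_nonneg) (auto simp: residual_nonneg)
  show "(\<integral>\<omega>. residual (Y \<omega>) \<partial>P) = (\<integral>\<omega>. (norm (T (\<kappa> \<omega>) (Y \<omega>) - Y \<omega>))\<^sup>2 \<partial>P)"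
    using fin nn_integral_eq_integral[OF *] by (simp add: residual_nonneg)
qed

text \<open>A vanishing residual is convergence to \<open>0\<close> in \<open>L\<^sup>1\<close> of \<open>\<parallel>T\<^sub>k v\<^sub>n - v\<^sub>n\<parallel>\<^sup>2\<close>, hence almost sure convergence along a subsequence.\<close>

lemma residual_subsequence:
  assumes z: "z \<in> common_fix" and "(\<lambda>n. residual (v n)) \<longlonglongrightarrow> 0"
  obtains r :: "nat \<Rightarrow> nat" where "strict_mono r"
    "AE \<omega> in P. (\<lambda>n. T (k \<omega>) (v (r n)) - v (r n)) \<longlonglongrightarrow> 0"
proof -
  have "\<exists>r::nat \<Rightarrow> nat. strict_mono r \<and> (AE \<omega> in P. (\<lambda>n. (norm (T (k \<omega>) (v (r n)) - v (r n)))\<^sup>2) \<longlonglongrightarrow> 0)"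
    using assms(2) by (intro tendsto_L1_AE_subseq residual_integrable[OF z]) (simp add: residual_def)
  then obtain r :: "nat \<Rightarrow> nat" where r: "strict_mono r"
    "AE \<omega> in P. (\<lambda>n. (norm (T (k \<omega>) (v (r n)) - v (r n)))\<^sup>2) \<longlonglongrightarrow> 0" by blast
  from r(2) have "AE \<omega> in P. (\<lambda>n. T (k \<omega>) (v (r n)) - v (r n)) \<longlonglongrightarrow> 0"
  proof eventually_elim
    case (elim \<omega>)
    from tendsto_real_sqrt[OF this] show ?case by (simp add: tendsto_norm_zero_iff)
  qed
  with r(1) show ?thesis by (rule that)
qed

lemma weak_cluster_in_common_fix:
  assumes demiclosed: "\<And>c. c \<in> space K \<Longrightarrow> id_minus_demiclosed_at_0 (T c)"
    and z: "z \<in> common_fix" and v: "weakly_converges v y" and res: "(\<lambda>n. residual (v n)) \<longlonglongrightarrow> 0"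
  shows "y \<in> common_fix"
proof -
  obtain r :: "nat \<Rightarrow> nat" where r: "strict_mono r"
    "AE \<omega> in P. (\<lambda>n. T (k \<omega>) (v (r n)) - v (r n)) \<longlonglongrightarrow> 0"
    using residual_subsequence[OF z res] .
  have "AE \<omega> in P. y \<in> Fix (T (k \<omega>))"
    using r(2) AE_space
  proof eventually_elim
    case (elim \<omega>)
    have "(\<lambda>n. (v \<circ> r) n - T (k \<omega>) ((v \<circ> r) n)) \<longlonglongrightarrow> 0"
      using tendsto_minus[OF elim(1)] by simp
    moreover have "id_minus_demiclosed_at_0 (T (k \<omega>))"
      using demiclosed measurable_space[OF k_rv elim(2)] by blast
    ultimately have "T (k \<omega>) y = y"
      using weakly_converges_subseq[OF v r(1)] unfolding id_minus_demiclosed_at_0_def by blast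
    then show ?case by (simp add: Fix_def)
  qed
  then show ?thesis by (simp add: common_fix_def)
qed

text \<open>Every subsequence of \<open>v\<close> has a further subsequence along which \<open>T\<^sub>k v\<^sub>n - v\<^sub>n \<rightarrow> 0\<close> for almost every outcome,
  hence for at least one outcome in \<open>S\<close>. The demiregular operator belonging to that outcome turns weak
  into strong convergence. The outcome may depend on the subsequence, but the limit does not.\<close>

lemma demiregular_imp_strong_convergence:
  assumes S: "S \<in> sets P" "0 < measure P S"
    and demireg: "\<And>\<omega> y. \<omega> \<in> S \<Longrightarrow> y \<in> Fix (T (k \<omega>)) \<Longrightarrow> demiregular_at (\<lambda>z. T (k \<omega>) z - z) y"
    and y: "y \<in> common_fix" and v: "weakly_converges v y" and res: "(\<lambda>n. residual (v n)) \<longlonglongrightarrow> 0"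
  shows "v \<longlonglongrightarrow> y"
proof (rule LIMSEQ_subsequence_principle)
  fix r :: "nat \<Rightarrow> nat" assume r: "strict_mono r"
  have "(\<lambda>n. residual ((v \<circ> r) n)) \<longlonglongrightarrow> 0"
    using LIMSEQ_subseq_LIMSEQ[OF res r] by (simp add: o_def)
  from residual_subsequence[OF y this]
  obtain s :: "nat \<Rightarrow> nat" where s: "strict_mono s"
    "AE \<omega> in P. (\<lambda>n. T (k \<omega>) ((v \<circ> r) (s n)) - (v \<circ> r) (s n)) \<longlonglongrightarrow> 0" .
  have "AE \<omega> in P. y \<in> Fix (T (k \<omega>))" using y by (simp add: common_fix_def)
  with s(2) have "AE \<omega> in P. y \<in> Fix (T (k \<omega>)) \<and>
      (\<lambda>n. T (k \<omega>) ((v \<circ> r) (s n)) - (v \<circ> r) (s n)) \<longlonglongrightarrow> 0"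
    by eventually_elim simp
  then obtain \<omega> where \<omega>: "\<omega> \<in> S" "y \<in> Fix (T (k \<omega>))"
    "(\<lambda>n. T (k \<omega>) ((v \<circ> r) (s n)) - (v \<circ> r) (s n)) \<longlonglongrightarrow> 0"
    using AE_positive_measure_witness[OF _ S] by blast
  have "weakly_converges (v \<circ> r \<circ> s) y"
    by (intro weakly_converges_subseq v r s)
  moreover have "(\<lambda>n. T (k \<omega>) ((v \<circ> r \<circ> s) n) - (v \<circ> r \<circ> s) n) \<longlonglongrightarrow> T (k \<omega>) y - y"
    using \<omega>(2,3) by (simp add: Fix_def)
  ultimately have "(v \<circ> r \<circ> s) \<longlonglongrightarrow> y"
    using demireg[OF \<omega>(1,2)] unfolding demiregular_at_def by blast
  with s(1) show "\<exists>s. strict_mono s \<and> (v \<circ> r \<circ> s) \<longlonglongrightarrow> y" by blast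
qed

end

section \<open>The extrapolated block iteration\<close>

locale extrapolated_block_iteration =
  random_firm_operator P K T k + complete_measure P
  for P :: "'w measure" and K :: "'k measure"
    and T :: "'k \<Rightarrow> 'a::{real_inner,complete_space,second_countable_topology} \<Rightarrow> 'a"
    and k :: "'w \<Rightarrow> 'k" +
  fixes m :: nat and \<delta> \<rho> \<mu> :: real
    and x p a :: "nat \<Rightarrow> 'w \<Rightarrow> 'a"
    and \<kappa> :: "nat \<Rightarrow> nat \<Rightarrow> 'w \<Rightarrow> 'k"
    and q :: "nat \<Rightarrow> nat \<Rightarrow> 'w \<Rightarrow> 'a"
    and \<beta> :: "nat \<Rightarrow> nat \<Rightarrow> 'w \<Rightarrow> real"
    and L \<Lambda> :: "nat \<Rightarrow> 'w \<Rightarrow> real"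
  assumes T_demiclosed: "\<And>c. c \<in> space K \<Longrightarrow> id_minus_demiclosed_at_0 (T c)"
    and common_fix_nonempty: "common_fix \<noteq> {}"
    and x0: "x 0 \<in> Lp 2 P UNIV"
    and m: "1 \<le> m"
    and \<delta>_pos: "0 < \<delta>"
    and \<kappa>_copy: "\<And>i n. i \<in> {1..m} \<Longrightarrow> is_copy P K k (\<kappa> i n)"
    and \<kappa>_indep: "\<And>i n. i \<in> {1..m} \<Longrightarrow> indep_set (sigma_rv P K (\<kappa> i n)) (sets (history P x n))"
    and q_eq: "\<And>i n \<omega>. i \<in> {1..m} \<Longrightarrow> \<omega> \<in> space P \<Longrightarrow> q i n \<omega> = T (\<kappa> i n \<omega>) (x n \<omega>)"
    and \<beta>_rv: "\<And>i n. i \<in> {1..m} \<Longrightarrow> \<beta> i n \<in> borel_measurable P"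
    and \<beta>_range: "\<And>i n. i \<in> {1..m} \<Longrightarrow> AE \<omega> in P. \<beta> i n \<omega> \<in> {0..1}"
    and \<beta>_sum: "\<And>n. AE \<omega> in P. (\<Sum>i\<in>{1..m}. \<beta> i n \<omega>) = 1"
    and \<beta>_max: "\<And>i n. i \<in> {1..m} \<Longrightarrow> AE \<omega> in P.
      \<beta> i n \<omega> \<ge> \<delta> * of_bool (norm (q i n \<omega> - x n \<omega>) = Max ((\<lambda>j. norm (q j n \<omega> - x n \<omega>)) ` {1..m}))"
    and p_eq: "\<And>n \<omega>. \<omega> \<in> space P \<Longrightarrow> p n \<omega> = (\<Sum>i\<in>{1..m}. \<beta> i n \<omega> *\<^sub>R q i n \<omega>)"
    and L_eq: "\<And>n \<omega>. \<omega> \<in> space P \<Longrightarrow> L n \<omega> =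
      ((\<Sum>i\<in>{1..m}. \<beta> i n \<omega> * (norm (q i n \<omega> - x n \<omega>))\<^sup>2) + of_bool (p n \<omega> = x n \<omega>))
        / ((norm (p n \<omega> - x n \<omega>))\<^sup>2 + of_bool (p n \<omega> = x n \<omega>))"
    and a_eq: "\<And>n \<omega>. \<omega> \<in> space P \<Longrightarrow> a n \<omega> = x n \<omega> + L n \<omega> *\<^sub>R (p n \<omega> - x n \<omega>)"
    and \<Lambda>_Linf: "\<And>n. \<Lambda> n \<in> Linf P {0<..\<rho>}"
    and x_Suc: "\<And>n. AE \<omega> in P. x (Suc n) \<omega> = x n \<omega> + \<Lambda> n \<omega> *\<^sub>R (a n \<omega> - x n \<omega>)"
    and \<mu>_gt_0: "0 < \<mu>"
    and \<Lambda>_mean: "\<And>n. \<mu> \<le> (\<integral>\<omega>. \<Lambda> n \<omega> * (2 - \<Lambda> n \<omega>) \<partial>P)"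
    and \<Lambda>_indep: "\<And>n. indep_set (sigma_rv P borel (\<Lambda> n))
      (sigma_sets (space P)
        ((\<Union>i\<in>{1..m}. sigma_rv P borel (q i n)) \<union> (\<Union>i\<in>{1..m}. sigma_rv P borel (\<beta> i n))
          \<union> (\<Union>j\<in>{..n}. sigma_rv P borel (x j))))"
begin

definition block_residual :: "nat \<Rightarrow> 'w \<Rightarrow> real" where
  "block_residual n \<omega> = (\<Sum>i\<in>{1..m}. \<beta> i n \<omega> * (norm (q i n \<omega> - x n \<omega>))\<^sup>2)"

definition displacement :: "nat \<Rightarrow> 'w \<Rightarrow> real" where
  "displacement n \<omega> = (norm (a n \<omega> - x n \<omega>))\<^sup>2"

lemma a_diff:
  assumes "\<omega> \<in> space P"
  shows "a n \<omega> - x n \<omega> = (block_residual n \<omega> / (norm (p n \<omega> - x n \<omega>))\<^sup>2) *\<^sub>R (p n \<omega> - x n \<omega>)"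
  using a_eq[OF assms] L_eq[OF assms] extrapolation_of_bool[of "block_residual n \<omega>" "p n \<omega>" "x n \<omega>"]
  by (simp add: block_residual_def)

text \<open>The sigma-algebra \<open>G\<close> is left open. It is instantiated with the full one, for the measurability of the
  iterates, and with the one generated by the data of step \<open>n\<close>, from which the relaxation parameter is
  independent.\<close>

lemma step_measurable:
  assumes G: "space G = space P" and x [measurable]: "x n \<in> borel_measurable G"
    and q: "\<And>i. i \<in> {1..m} \<Longrightarrow> q i n \<in> borel_measurable G"
    and \<beta>: "\<And>i. i \<in> {1..m} \<Longrightarrow> \<beta> i n \<in> borel_measurable G"
  shows "(\<lambda>\<omega>. a n \<omega> - x n \<omega>) \<in> borel_measurable G" "displacement n \<in> borel_measurable G"
proof -
  have d [measurable]: "block_residual n \<in> borel_measurable G"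
    unfolding block_residual_def
  proof (rule borel_measurable_sum)
    fix i assume i: "i \<in> {1..m}"
    note [measurable] = q[OF i] \<beta>[OF i]
    show "(\<lambda>\<omega>. \<beta> i n \<omega> * (norm (q i n \<omega> - x n \<omega>))\<^sup>2) \<in> borel_measurable G" by measurable
  qed
  have sum: "(\<lambda>\<omega>. \<Sum>i\<in>{1..m}. \<beta> i n \<omega> *\<^sub>R q i n \<omega>) \<in> borel_measurable G"
  proof (rule borel_measurable_sum)
    fix i assume i: "i \<in> {1..m}"
    note [measurable] = q[OF i] \<beta>[OF i]
    show "(\<lambda>\<omega>. \<beta> i n \<omega> *\<^sub>R q i n \<omega>) \<in> borel_measurable G" by measurable
  qed
  have [measurable]: "p n \<in> borel_measurable G"
    using measurable_cong[of G "p n" "\<lambda>\<omega>. \<Sum>i\<in>{1..m}. \<beta> i n \<omega> *\<^sub>R q i n \<omega>" borel] sum p_eq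
    unfolding G by blast
  have "(\<lambda>\<omega>. (block_residual n \<omega> / (norm (p n \<omega> - x n \<omega>))\<^sup>2) *\<^sub>R (p n \<omega> - x n \<omega>)) \<in> borel_measurable G"
    by measurable
  then show [measurable]: "(\<lambda>\<omega>. a n \<omega> - x n \<omega>) \<in> borel_measurable G"
    by (subst measurable_cong[OF a_diff]) (auto simp: G)
  show "displacement n \<in> borel_measurable G"
    unfolding displacement_def by measurable
qed

lemma q_measurable_if:
  assumes [measurable]: "x n \<in> borel_measurable P" and i: "i \<in> {1..m}"
  shows "q i n \<in> borel_measurable P"
proof -
  have [measurable]: "\<kappa> i n \<in> measurable P K" using \<kappa>_copy[OF i] by (simp add: is_copy_def)
  have "(\<lambda>\<omega>. T (\<kappa> i n \<omega>) (x n \<omega>)) \<in> borel_measurable P" by measurable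
  then show ?thesis by (subst measurable_cong[OF q_eq[OF i]]) auto
qed

text \<open>The recursion determines \<open>x (Suc n)\<close> only almost surely; completeness of the measure makes it measurable.\<close>

lemma x_measurable [measurable]: "x n \<in> borel_measurable P"
proof (induction n)
  case 0
  show ?case using x0 by (simp add: Lp_def)
next
  case (Suc n)
  note [measurable] = Suc relaxation_bounds(1)[OF \<Lambda>_Linf]
  have [measurable]: "(\<lambda>\<omega>. a n \<omega> - x n \<omega>) \<in> borel_measurable P"
    by (rule step_measurable(1)) (auto intro: Suc q_measurable_if \<beta>_rv)
  have "(\<lambda>\<omega>. x n \<omega> + \<Lambda> n \<omega> *\<^sub>R (a n \<omega> - x n \<omega>)) \<in> borel_measurable P" by measurable
  then show ?case using x_Suc by (rule borel_measurable_AE_eq)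
qed

lemma q_measurable: "i \<in> {1..m} \<Longrightarrow> q i n \<in> borel_measurable P"
  by (rule q_measurable_if[OF x_measurable])

lemma displacement_measurable [measurable]: "displacement n \<in> borel_measurable P"
  by (rule step_measurable(2)) (auto intro: q_measurable \<beta>_rv x_measurable)

lemma AE_block_step:
  assumes z: "z \<in> common_fix"
  shows "AE \<omega> in P. block_residual n \<omega> \<le> displacement n \<omega> \<and>
    (norm (a n \<omega> - x n \<omega>))\<^sup>2 \<le> inner (z - x n \<omega>) (a n \<omega> - x n \<omega>)"
proof -
  have "AE \<omega> in P. \<forall>i\<in>{1..m}. z \<in> Fix (T (\<kappa> i n \<omega>)) \<and> \<beta> i n \<omega> \<in> {0..1}"
  proof (rule AE_finite_allI)
    fix i assume i: "i \<in> {1..m}"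
    show "AE \<omega> in P. z \<in> Fix (T (\<kappa> i n \<omega>)) \<and> \<beta> i n \<omega> \<in> {0..1}"
      using AE_fix_copy[OF \<kappa>_copy[OF i] z] \<beta>_range[OF i] by (rule AE_conjI)
  qed simp
  then show ?thesis
    using \<beta>_sum[of n] AE_space[of P]
  proof eventually_elim
    case (elim \<omega>)
    have "(norm (q i n \<omega> - x n \<omega>))\<^sup>2 \<le> inner (z - x n \<omega>) (q i n \<omega> - x n \<omega>)" if i: "i \<in> {1..m}" for i
    proof -
      have "\<kappa> i n \<in> measurable P K" using \<kappa>_copy[OF i] by (simp add: is_copy_def)
      from measurable_space[OF this elim(3)] have "\<kappa> i n \<omega> \<in> space K" .
      from fqn_inner_ge[OF T_fqn[OF this]] elim(1) i show ?thesis
        by (simp add: q_eq[OF i elim(3)])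
    qed
    with elim(1,2) extrapolated_step[of "{1..m}" "\<lambda>i. \<beta> i n \<omega>" "\<lambda>i. q i n \<omega>" "x n \<omega>" z]
    show ?case
      unfolding displacement_def a_diff[OF elim(3)] block_residual_def p_eq[OF elim(3)] by simp
  qed
qed

lemma AE_displacement_le:
  assumes "z \<in> common_fix"
  shows "AE \<omega> in P. displacement n \<omega> \<le> (norm (x n \<omega> - z))\<^sup>2"
  using AE_block_step[OF assms, of n]
proof eventually_elim
  case (elim \<omega>)
  then have "norm (a n \<omega> - x n \<omega>) \<le> norm (z - x n \<omega>)"
    by (intro norm_le_of_inner_ge) simp
  also have "\<dots> = norm (x n \<omega> - z)" by (rule norm_minus_commute)
  finally have "norm (a n \<omega> - x n \<omega>) \<le> norm (x n \<omega> - z)" .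
  then show ?case unfolding displacement_def by (intro power_mono) auto
qed

lemma AE_step:
  assumes "z \<in> common_fix"
  shows "AE \<omega> in P. (norm (x (Suc n) \<omega> - z))\<^sup>2
    \<le> (norm (x n \<omega> - z))\<^sup>2 - \<Lambda> n \<omega> * (2 - \<Lambda> n \<omega>) * displacement n \<omega>"
  using AE_block_step[OF assms, of n] x_Suc[of n] relaxation_bounds(2)[OF \<Lambda>_Linf, of n]
proof eventually_elim
  case (elim \<omega>)
  from elim(1) have "(norm (a n \<omega> - x n \<omega>))\<^sup>2 \<le> inner (z - x n \<omega>) (a n \<omega> - x n \<omega>)" ..
  moreover from elim(3) have "0 \<le> \<Lambda> n \<omega>" by simp
  ultimately show ?case unfolding displacement_def elim(2) by (rule relaxed_step)
qed

text \<open>Since \<open>\<lambda>\<^sub>n (2 - \<lambda>\<^sub>n) \<ge> - \<rho>\<^sup>2\<close>, a relaxation beyond \<open>2\<close> costs at most \<open>\<rho>\<^sup>2\<close> times the squared displacement.\<close>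

sublocale pathwise_quasi_fejer P x common_fix displacement "\<rho>\<^sup>2"
proof
  show "integrable P (\<lambda>\<omega>. (norm (x 0 \<omega>))\<^sup>2)" using x0 by (simp add: Lp_def)
  fix n z assume z: "z \<in> common_fix"
  show "AE \<omega> in P. displacement n \<omega> \<le> (norm (x n \<omega> - z))\<^sup>2" by (rule AE_displacement_le[OF z])
  show "AE \<omega> in P. (norm (x (Suc n) \<omega> - z))\<^sup>2 \<le> (norm (x n \<omega> - z))\<^sup>2 + \<rho>\<^sup>2 * displacement n \<omega>"
    using AE_step[OF z, of n] relaxation_bounds(2)[OF \<Lambda>_Linf, of n]
  proof eventually_elim
    case (elim \<omega>)
    have "(\<Lambda> n \<omega>)\<^sup>2 \<le> \<rho>\<^sup>2" using elim(2) by (intro power_mono) auto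
    with elim(2) have "- \<rho>\<^sup>2 \<le> \<Lambda> n \<omega> * (2 - \<Lambda> n \<omega>)"
      by (simp add: algebra_simps power2_eq_square)
    then have "- \<rho>\<^sup>2 * displacement n \<omega> \<le> \<Lambda> n \<omega> * (2 - \<Lambda> n \<omega>) * displacement n \<omega>"
      by (intro mult_right_mono) (simp_all add: displacement_def)
    with elim(1) show ?case by simp
  qed
qed (use common_fix_nonempty in \<open>auto simp: displacement_def\<close>)

text \<open>The displacement and \<open>A\<close> are measurable with respect to the data from which \<open>\<Lambda> n\<close> is independent, so that the
  mean of \<open>\<Lambda> n (2 - \<Lambda> n)\<close> factors out of the integral.\<close>

lemma mean_step_relaxed:
  assumes z: "z \<in> common_fix" and A: "A \<in> sets (history P x n)"
  shows "(\<integral>\<omega>. indicator A \<omega> * (norm (x (Suc n) \<omega> - z))\<^sup>2 \<partial>P)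
    \<le> (\<integral>\<omega>. indicator A \<omega> * ((norm (x n \<omega> - z))\<^sup>2 - \<mu> * displacement n \<omega>) \<partial>P)"
proof -
  let ?gen = "(\<Union>i\<in>{1..m}. sigma_rv P borel (q i n)) \<union> (\<Union>i\<in>{1..m}. sigma_rv P borel (\<beta> i n))
      \<union> (\<Union>j\<in>{..n}. sigma_rv P borel (x j))"
  define G where "G = sigma (space P) ?gen"
  have gen: "?gen \<subseteq> Pow (space P)" by (intro Un_least UN_least sigma_rv_subset_Pow)
  have space_G: "space G = space P" using gen by (simp add: G_def space_measure_of)
  have sets_G: "sets G = sigma_sets (space P) ?gen" using gen by (simp add: G_def sets_measure_of)
  have meas_G: "f \<in> borel_measurable G" if "sigma_rv P borel f \<subseteq> ?gen" for f :: "'w \<Rightarrow> 'c::topological_space"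
    using that by (intro measurable_sigma_rv[of _ P]) (auto simp: space_G sets_G)
  have disp_G: "displacement n \<in> borel_measurable G"
    by (rule step_measurable(2)) (auto intro!: meas_G simp: space_G)
  have A_G: "A \<in> sets G"
    using A unfolding sets_G sets_history by (rule subsetD[OF sigma_sets_mono', rotated]) auto
  have [measurable]: "A \<in> sets P" using A history_subset[of x P n] x_measurable by blast
  let ?f = "\<lambda>\<omega>. \<Lambda> n \<omega> * (2 - \<Lambda> n \<omega>)" and ?g = "\<lambda>\<omega>. indicator A \<omega> * displacement n \<omega>"
  have f_sub: "sigma_rv P borel ?f \<subseteq> sigma_rv P borel (\<Lambda> n)"
  proof -
    have [measurable]: "\<Lambda> n \<in> borel_measurable (vimage_algebra (space P) (\<Lambda> n) borel)"
      by (rule measurable_vimage_algebra1) simp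
    have "?f \<in> borel_measurable (vimage_algebra (space P) (\<Lambda> n) borel)" by measurable
    from sigma_rv_subset_of_measurable[OF this, of P] show ?thesis by (simp add: sigma_rv_def)
  qed
  have "?g \<in> borel_measurable G"
    by (intro borel_measurable_times borel_measurable_indicator disp_G A_G)
  then have g_sub: "sigma_rv P borel ?g \<subseteq> sigma_sets (space P) ?gen"
    using sigma_rv_subset_of_measurable[of ?g G borel P] by (simp add: space_G sets_G)
  have int_f: "integrable P ?f" by (rule relaxation_bounds(3)[OF \<Lambda>_Linf])
  have int_g: "integrable P ?g" by (rule integrable_indicator_mult[OF A integrable_e])
  note prod = integral_mult_of_indep_set[OF int_f int_g \<Lambda>_indep f_sub g_sub]
  have int_x: "integrable P (\<lambda>\<omega>. indicator A \<omega> * (norm (x j \<omega> - z))\<^sup>2)" for j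
    by (rule integrable_indicator_mult[OF A integrable_dist_sq[OF z]])
  have "(\<integral>\<omega>. indicator A \<omega> * (norm (x (Suc n) \<omega> - z))\<^sup>2 \<partial>P)
      \<le> (\<integral>\<omega>. indicator A \<omega> * (norm (x n \<omega> - z))\<^sup>2 - ?f \<omega> * ?g \<omega> \<partial>P)"
  proof (rule integral_mono_AE[OF int_x Bochner_Integration.integrable_diff[OF int_x prod(2)]])
    show "AE \<omega> in P. indicator A \<omega> * (norm (x (Suc n) \<omega> - z))\<^sup>2
        \<le> indicator A \<omega> * (norm (x n \<omega> - z))\<^sup>2 - ?f \<omega> * ?g \<omega>"
      using AE_step[OF z, of n] by eventually_elim (auto simp: indicator_def)
  qed
  also have "\<dots> = (\<integral>\<omega>. indicator A \<omega> * (norm (x n \<omega> - z))\<^sup>2 \<partial>P)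
      - (\<integral>\<omega>. ?f \<omega> \<partial>P) * (\<integral>\<omega>. ?g \<omega> \<partial>P)"
    by (subst Bochner_Integration.integral_diff[OF int_x prod(2)]) (simp only: prod(1))
  also have "\<dots> \<le> (\<integral>\<omega>. indicator A \<omega> * (norm (x n \<omega> - z))\<^sup>2 \<partial>P) - \<mu> * (\<integral>\<omega>. ?g \<omega> \<partial>P)"
    by (intro diff_left_mono mult_right_mono \<Lambda>_mean integral_nonneg_AE AE_I2) (simp add: displacement_def)
  also have "\<dots> = (\<integral>\<omega>. indicator A \<omega> * (norm (x n \<omega> - z))\<^sup>2 - \<mu> * ?g \<omega> \<partial>P)"
    using int_x int_g by simp
  also have "\<dots> = (\<integral>\<omega>. indicator A \<omega> * ((norm (x n \<omega> - z))\<^sup>2 - \<mu> * displacement n \<omega>) \<partial>P)"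
    by (simp add: algebra_simps)
  finally show ?thesis .
qed

sublocale stochastic_fejer P x common_fix displacement "\<rho>\<^sup>2" \<mu>
  by unfold_locales (fact \<mu>_gt_0 mean_step_relaxed)+

text \<open>The largest block residual carries weight at least \<open>\<delta>\<close>, so the displacement dominates \<open>\<delta>\<close> times the squared
  residual of every block, in particular of the first, which exists because \<open>m \<ge> 1\<close>. Its index is a copy of \<open>k\<close>
  that is independent of \<open>x n\<close>.\<close>

lemma mean_residual_le_displacement:
  shows "integrable P (\<lambda>\<omega>. residual (x n \<omega>))"
    and "\<delta> * (\<integral>\<omega>. residual (x n \<omega>) \<partial>P) \<le> (\<integral>\<omega>. displacement n \<omega> \<partial>P)"
proof -
  obtain z where z: "z \<in> common_fix" using common_fix_nonempty by blast
  have one: "1 \<in> {1..m}" using m by simp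
  have \<kappa>1 [measurable]: "\<kappa> 1 n \<in> measurable P K" using \<kappa>_copy[OF one] by (simp add: is_copy_def)
  let ?r = "\<lambda>\<omega>. (norm (T (\<kappa> 1 n \<omega>) (x n \<omega>) - x n \<omega>))\<^sup>2"
  have int: "integrable P ?r"
  proof (rule Bochner_Integration.integrable_bound[OF integrable_dist_sq[OF z, of n]])
    show "AE \<omega> in P. norm (?r \<omega>) \<le> norm ((norm (x n \<omega> - z))\<^sup>2)"
      using AE_fix_copy[OF \<kappa>_copy[OF one] z, of n] AE_space[of P]
    proof eventually_elim
      case (elim \<omega>)
      from fqn_residual_le[OF T_fqn[OF measurable_space[OF \<kappa>1 elim(2)]] elim(1)]
      show ?case by simp
    qed
  qed measurable
  have "sigma_rv P borel (x n) \<subseteq> sets (history P x n)"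
    unfolding sets_history by (auto intro: sigma_sets.Basic)
  note copy = mean_residual_copy[OF \<kappa>_copy[OF one] x_measurable \<kappa>_indep[OF one] this z int]
  show "integrable P (\<lambda>\<omega>. residual (x n \<omega>))" by (rule copy(1))
  have "AE \<omega> in P. \<forall>i\<in>{1..m}. \<beta> i n \<omega> \<in> {0..1} \<and>
      \<delta> * of_bool (norm (q i n \<omega> - x n \<omega>) = Max ((\<lambda>j. norm (q j n \<omega> - x n \<omega>)) ` {1..m})) \<le> \<beta> i n \<omega>"
  proof (rule AE_finite_allI)
    fix i assume i: "i \<in> {1..m}"
    show "AE \<omega> in P. \<beta> i n \<omega> \<in> {0..1} \<and>
      \<delta> * of_bool (norm (q i n \<omega> - x n \<omega>) = Max ((\<lambda>j. norm (q j n \<omega> - x n \<omega>)) ` {1..m})) \<le> \<beta> i n \<omega>"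
      using \<beta>_range[OF i] \<beta>_max[OF i] by (rule AE_conjI)
  qed simp
  then have "AE \<omega> in P. \<delta> * ?r \<omega> \<le> displacement n \<omega>"
    using AE_block_step[OF z, of n] AE_space[of P]
  proof eventually_elim
    case (elim \<omega>)
    have "\<delta> * (norm (q 1 n \<omega> - x n \<omega>))\<^sup>2 \<le> block_residual n \<omega>"
      unfolding block_residual_def
      by (rule block_residual_ge) (use elim(1) one \<delta>_pos in auto)
    with elim(2) show ?case unfolding q_eq[OF one elim(3)] by linarith
  qed
  then have "(\<integral>\<omega>. \<delta> * ?r \<omega> \<partial>P) \<le> (\<integral>\<omega>. displacement n \<omega> \<partial>P)"
    using int by (intro integral_mono_AE integrable_e) auto
  then show "\<delta> * (\<integral>\<omega>. residual (x n \<omega>) \<partial>P) \<le> (\<integral>\<omega>. displacement n \<omega> \<partial>P)"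
    by (simp add: copy(2))
qed

lemma AE_residual_tendsto_0: "AE \<omega> in P. (\<lambda>n. residual (x n \<omega>)) \<longlonglongrightarrow> 0"
proof -
  have "summable (\<lambda>n. \<integral>\<omega>. residual (x n \<omega>) \<partial>P)"
  proof (rule summable_comparison_test')
    show "summable (\<lambda>n. (\<integral>\<omega>. displacement n \<omega> \<partial>P) / \<delta>)"
      by (intro summable_divide mean_e_summable)
    show "norm (\<integral>\<omega>. residual (x n \<omega>) \<partial>P) \<le> (\<integral>\<omega>. displacement n \<omega> \<partial>P) / \<delta>" if "0 \<le> n" for n
      using mean_residual_le_displacement(2)[of n] \<delta>_pos
      by (simp add: residual_nonneg pos_le_divide_eq mult.commute)
  qed
  then have "AE \<omega> in P. summable (\<lambda>n. residual (x n \<omega>))"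
    by (intro summable_integrals_imp_AE_summable mean_residual_le_displacement residual_nonneg)
  then show ?thesis by eventually_elim (rule summable_LIMSEQ_zero)
qed

lemma AE_weak_clusters_in_common_fix:
  "AE \<omega> in P. \<forall>r y. strict_mono r \<longrightarrow> weakly_converges ((\<lambda>n. x n \<omega>) \<circ> r) y \<longrightarrow> y \<in> common_fix"
  using AE_residual_tendsto_0
proof eventually_elim
  case (elim \<omega>)
  obtain z where z: "z \<in> common_fix" using common_fix_nonempty by blast
  show ?case
  proof (intro allI impI)
    fix r :: "nat \<Rightarrow> nat" and y
    assume r: "strict_mono r" and weak: "weakly_converges ((\<lambda>n. x n \<omega>) \<circ> r) y"
    have "(\<lambda>n. residual (((\<lambda>n. x n \<omega>) \<circ> r) n)) \<longlonglongrightarrow> 0"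
      using LIMSEQ_subseq_LIMSEQ[OF elim r] by (simp add: o_def)
    from weak_cluster_in_common_fix[OF T_demiclosed z weak this] show "y \<in> common_fix" .
  qed
qed

lemma AE_strong_convergence_of_demiregular:
  assumes S: "S \<in> sets P" "0 < measure P S"
    and demireg: "\<And>\<omega> y. \<omega> \<in> S \<Longrightarrow> y \<in> Fix (T (k \<omega>)) \<Longrightarrow> demiregular_at (\<lambda>z. T (k \<omega>) z - z) y"
    and y: "AE \<omega> in P. y \<omega> \<in> common_fix" "AE \<omega> in P. weakly_converges (\<lambda>n. x n \<omega>) (y \<omega>)"
  shows "AE \<omega> in P. (\<lambda>n. x n \<omega>) \<longlonglongrightarrow> y \<omega>"
  using AE_residual_tendsto_0 y
proof eventually_elim
  case (elim \<omega>)
  show ?case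
    by (rule demiregular_imp_strong_convergence[OF S demireg elim(2,3,1)])
qed

lemma contraction_of_cond_exp:
  assumes "AE \<omega> in P. real_cond_exp P (history P x n) (\<lambda>\<omega>. (infdist (x (Suc n) \<omega>) common_fix)\<^sup>2) \<omega>
      \<le> \<theta> * (infdist (x n \<omega>) common_fix)\<^sup>2"
  shows "(\<integral>\<omega>. (infdist (x (Suc n) \<omega>) common_fix)\<^sup>2 \<partial>P) \<le> \<theta> * (\<integral>\<omega>. (infdist (x n \<omega>) common_fix)\<^sup>2 \<partial>P)"
proof -
  interpret finite_measure_subalgebra P "history P x n"
    by unfold_locales (use history_subset[of x P n] x_measurable in \<open>auto simp: subalgebra_def\<close>)
  note ce = real_cond_exp_int[OF integrable_infdist_sq[of "Suc n"]]
  have "(\<integral>\<omega>. (infdist (x (Suc n) \<omega>) common_fix)\<^sup>2 \<partial>P)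
      = (\<integral>\<omega>. real_cond_exp P (history P x n) (\<lambda>\<omega>. (infdist (x (Suc n) \<omega>) common_fix)\<^sup>2) \<omega> \<partial>P)"
    by (rule ce(2)[symmetric])
  also have "\<dots> \<le> (\<integral>\<omega>. \<theta> * (infdist (x n \<omega>) common_fix)\<^sup>2 \<partial>P)"
    by (rule integral_mono_AE[OF ce(1) _ assms]) (use integrable_infdist_sq in auto)
  finally show ?thesis by simp
qed

text \<open>The mean of \<open>d\<^sub>Z(x\<^sub>n)\<^sup>2\<close> decreases by \<open>\<mu> E \<parallel>a\<^sub>n - x\<^sub>n\<parallel>\<^sup>2\<close>. This is at least \<open>\<mu> \<delta>\<close> times the mean residual at \<open>x\<^sub>n\<close>,
  and linear regularity bounds the residual below by \<open>d\<^sub>Z(x\<^sub>n)\<^sup>2 / \<nu>\<close>.\<close>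

lemma contraction_of_linear_regularity:
  assumes regular: "\<And>y. (infdist y common_fix)\<^sup>2 \<le> \<nu> * residual y" and \<nu>: "0 < \<nu>"
  shows "(\<integral>\<omega>. (infdist (x (Suc n) \<omega>) common_fix)\<^sup>2 \<partial>P)
    \<le> (1 - \<mu> * \<delta> / \<nu>) * (\<integral>\<omega>. (infdist (x n \<omega>) common_fix)\<^sup>2 \<partial>P)"
proof -
  let ?D = "\<lambda>n. \<integral>\<omega>. (infdist (x n \<omega>) common_fix)\<^sup>2 \<partial>P"
  have "?D n \<le> (\<integral>\<omega>. \<nu> * residual (x n \<omega>) \<partial>P)"
    by (intro integral_mono integrable_infdist_sq regular) (use mean_residual_le_displacement(1) in simp)
  then have "?D n / \<nu> \<le> (\<integral>\<omega>. residual (x n \<omega>) \<partial>P)"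
    using \<nu> by (simp add: pos_divide_le_eq mult.commute)
  then have "\<delta> * (?D n / \<nu>) \<le> \<delta> * (\<integral>\<omega>. residual (x n \<omega>) \<partial>P)"
    using \<delta>_pos by (intro mult_left_mono) auto
  also have "\<dots> \<le> (\<integral>\<omega>. displacement n \<omega> \<partial>P)" by (rule mean_residual_le_displacement(2))
  finally have "\<mu> * (\<delta> * (?D n / \<nu>)) \<le> \<mu> * (\<integral>\<omega>. displacement n \<omega> \<partial>P)"
    using \<mu>_gt_0 by (intro mult_left_mono) auto
  with mean_infdist_step[of n] show ?thesis by (simp add: algebra_simps)
qed

end

section \<open>Convergence of the iteration\<close>

theorem theorem5p4:
  fixes P :: "'w measure"
    and K :: "'k measure"
    and T :: "'k \<Rightarrow> 'a::{real_inner,complete_space,second_countable_topology} \<Rightarrow> 'a"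
    and k :: "'w \<Rightarrow> 'k"
    and Z :: "'a set"
    and m :: nat
    and \<delta> \<rho> \<mu> :: real
    and x p a :: "nat \<Rightarrow> 'w \<Rightarrow> 'a"
    and \<kappa> :: "nat \<Rightarrow> nat \<Rightarrow> 'w \<Rightarrow> 'k"
    and q :: "nat \<Rightarrow> nat \<Rightarrow> 'w \<Rightarrow> 'a"
    and \<beta> :: "nat \<Rightarrow> nat \<Rightarrow> 'w \<Rightarrow> real"
    and L \<Lambda> :: "nat \<Rightarrow> 'w \<Rightarrow> real"
  assumes prob: "prob_space P"
    and complete: "complete_measure P"
    and T_fqn: "\<forall>c\<in>space K. firmly_quasinonexpansive (T c)"
    and T_meas: "(\<lambda>(c, y). T c y) \<in> measurable (K \<Otimes>\<^sub>M borel) borel"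
    and T_demiclosed: "\<forall>c\<in>space K. id_minus_demiclosed_at_0 (T c)"
    and k_rv: "k \<in> measurable P K"
    and Z_eq: "Z = {z. AE \<omega> in P. z \<in> Fix (T (k \<omega>))}"
    and Z_nonempty: "Z \<noteq> {}"
    and x0: "x 0 \<in> Lp 2 P UNIV"
    and m: "1 \<le> m"
    and \<delta>: "0 < \<delta>" "\<delta> < 1 / real m"
    and \<rho>: "2 \<le> \<rho>"
    and \<kappa>_copy: "\<forall>n. \<forall>i\<in>{1..m}. is_copy P K k (\<kappa> i n)"
    and \<kappa>_indep: "\<forall>n. \<forall>i\<in>{1..m}.
      prob_space.indep_set P (sigma_rv P K (\<kappa> i n)) (sets (history P x n))"
    and q_eq: "\<forall>n. \<forall>i\<in>{1..m}. \<forall>\<omega>\<in>space P. q i n \<omega> = T (\<kappa> i n \<omega>) (x n \<omega>)"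
    and \<beta>_rv: "\<forall>n. \<forall>i\<in>{1..m}. \<beta> i n \<in> borel_measurable P \<and> (AE \<omega> in P. \<beta> i n \<omega> \<in> {0..1})"
    and \<beta>_sum: "\<forall>n. AE \<omega> in P. (\<Sum>i\<in>{1..m}. \<beta> i n \<omega>) = 1"
    and \<beta>_max: "\<forall>n. \<forall>i\<in>{1..m}. AE \<omega> in P.
      \<beta> i n \<omega> \<ge> \<delta> * of_bool (norm (q i n \<omega> - x n \<omega>) = Max ((\<lambda>j. norm (q j n \<omega> - x n \<omega>)) ` {1..m}))"
    and p_eq: "\<forall>n. \<forall>\<omega>\<in>space P. p n \<omega> = (\<Sum>i\<in>{1..m}. \<beta> i n \<omega> *\<^sub>R q i n \<omega>)"
    and L_eq: "\<forall>n. \<forall>\<omega>\<in>space P. L n \<omega> =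
      ((\<Sum>i\<in>{1..m}. \<beta> i n \<omega> * (norm (q i n \<omega> - x n \<omega>))\<^sup>2) + of_bool (p n \<omega> = x n \<omega>))
        / ((norm (p n \<omega> - x n \<omega>))\<^sup>2 + of_bool (p n \<omega> = x n \<omega>))"
    and a_eq: "\<forall>n. \<forall>\<omega>\<in>space P. a n \<omega> = x n \<omega> + L n \<omega> *\<^sub>R (p n \<omega> - x n \<omega>)"
    and \<Lambda>_Linf: "\<forall>n. \<Lambda> n \<in> Linf P {0<..\<rho>}"
    and x_Suc: "\<forall>n. AE \<omega> in P. x (Suc n) \<omega> = x n \<omega> + \<Lambda> n \<omega> *\<^sub>R (a n \<omega> - x n \<omega>)"
    and \<mu>: "0 < \<mu>" "\<mu> < 1"
    and \<Lambda>_inf: "(INF n. \<integral>\<omega>. \<Lambda> n \<omega> * (2 - \<Lambda> n \<omega>) \<partial>P) \<ge> \<mu>"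
    and \<Lambda>_indep: "\<forall>n. prob_space.indep_set P (sigma_rv P borel (\<Lambda> n))
      (sigma_sets (space P)
        ((\<Union>i\<in>{1..m}. sigma_rv P borel (q i n)) \<union> (\<Union>i\<in>{1..m}. sigma_rv P borel (\<beta> i n))
          \<union> (\<Union>j\<in>{..n}. sigma_rv P borel (x j))))"
  shows "\<exists>x_lim \<in> Lp 2 P Z.
    (L2_weakly_converges P x x_lim \<and> (AE \<omega> in P. weakly_converges (\<lambda>n. x n \<omega>) (x_lim \<omega>))) \<and>
    ((\<exists>S\<in>sets P.
        S \<subseteq> {\<omega> \<in> space P. \<forall>y\<in>Fix (T (k \<omega>)). demiregular_at (\<lambda>z. T (k \<omega>) z - z) y} \<and>
        measure P S > 0)
      \<longrightarrow> Lp_converges 1 P x x_lim \<and> (AE \<omega> in P. (\<lambda>n. x n \<omega>) \<longlonglongrightarrow> x_lim \<omega>)) \<and>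
    (\<forall>\<theta>.
      (0 < \<theta> \<and> \<theta> < 1 \<and>
        (\<forall>n. AE \<omega> in P.
          real_cond_exp P (history P x n) (\<lambda>\<omega>. (infdist (x (Suc n) \<omega>) Z)\<^sup>2) \<omega>
            \<le> \<theta> * (infdist (x n \<omega>) Z)\<^sup>2)) \<or>
      (\<exists>\<nu>\<ge>1.
        (\<forall>y. (infdist y Z)\<^sup>2 \<le> \<nu> * (\<integral>\<omega>. (norm (T (k \<omega>) y - y))\<^sup>2 \<partial>P)) \<and>
        \<theta> = 1 - \<mu> * \<delta> * (INF j. \<integral>\<omega>. (\<Lambda> j \<omega>)\<^sup>2 \<partial>P) / (\<rho>\<^sup>2 * \<nu>))
      \<longrightarrow> Lp_converges 2 P x x_lim \<and> (AE \<omega> in P. (\<lambda>n. x n \<omega>) \<longlonglongrightarrow> x_lim \<omega>) \<and>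
        (\<forall>n. (\<integral>\<omega>. (norm (x n \<omega> - x_lim \<omega>))\<^sup>2 \<partial>P)
               \<le> 4 * \<theta> ^ n * (\<integral>\<omega>. (infdist (x 0 \<omega>) Z)\<^sup>2 \<partial>P)))"
proof -
  interpret prob_space P by (rule prob)
  interpret complete_measure P by (rule complete)
  interpret random_firm_operator P K T k
    by unfold_locales (use T_fqn T_meas k_rv in auto)
  have Z: "Z = common_fix" by (simp add: Z_eq common_fix_def)
  have "1 / real m \<le> 1" using m by simp
  with \<delta> have "\<delta> \<le> 1" by linarith
  then have \<mu>\<delta>: "\<mu> * \<delta> \<le> 1" "0 < \<mu> * \<delta>" using \<mu> \<delta> by (auto intro: mult_le_one)
  have \<Lambda>_mean: "\<mu> \<le> (\<integral>\<omega>. \<Lambda> n \<omega> * (2 - \<Lambda> n \<omega>) \<partial>P)" for n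
  proof -
    have "bdd_below (range (\<lambda>n. \<integral>\<omega>. \<Lambda> n \<omega> * (2 - \<Lambda> n \<omega>) \<partial>P))"
      using relaxation_bounds(4) \<Lambda>_Linf by (intro bdd_belowI[of _ "- \<rho>\<^sup>2"]) auto
    from cINF_lower[OF this, of n] \<Lambda>_inf show ?thesis by simp
  qed
  interpret extrapolated_block_iteration P K T k m \<delta> \<rho> \<mu> x p a \<kappa> q \<beta> L \<Lambda>
    by unfold_locales
      (use T_demiclosed in blast, use Z_nonempty Z in simp, rule x0, rule m, rule \<delta>(1),
        use \<kappa>_copy in blast, use \<kappa>_indep in blast, use q_eq in blast, use \<beta>_rv in blast,
        use \<beta>_rv in blast, use \<beta>_sum in blast, use \<beta>_max in blast, use p_eq in blast,
        use L_eq in blast, use a_eq in blast, use \<Lambda>_Linf in blast, use x_Suc in blast,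
        rule \<mu>(1), rule \<Lambda>_mean, use \<Lambda>_indep in blast)
  obtain y where y: "y \<in> borel_measurable P" "AE \<omega> in P. y \<omega> \<in> common_fix"
    "AE \<omega> in P. weakly_converges (\<lambda>n. x n \<omega>) (y \<omega>)"
    using weak_limit_exists[OF AE_weak_clusters_in_common_fix] .
  interpret weakly_convergent_stochastic_fejer P x common_fix displacement "\<rho>\<^sup>2" \<mu> y
    by unfold_locales (fact y)+
  have in_Lp: "y \<in> Lp 2 P Z" using limit_in_L2 y(2) by (simp add: Lp_def Z)
  have demiregular_case: "Lp_converges 1 P x y \<and> (AE \<omega> in P. (\<lambda>n. x n \<omega>) \<longlonglongrightarrow> y \<omega>)"
    if S: "S \<in> sets P" "S \<subseteq> {\<omega> \<in> space P. \<forall>y\<in>Fix (T (k \<omega>)). demiregular_at (\<lambda>z. T (k \<omega>) z - z) y}"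
      "measure P S > 0" for S
  proof -
    have strong: "AE \<omega> in P. (\<lambda>n. x n \<omega>) \<longlonglongrightarrow> y \<omega>"
      by (rule AE_strong_convergence_of_demiregular[OF S(1,3) _ y(2,3)]) (use S(2) in blast)
    with L1_convergent show ?thesis by blast
  qed
  have cond_exp_case: "Lp_converges 2 P x y \<and> (AE \<omega> in P. (\<lambda>n. x n \<omega>) \<longlonglongrightarrow> y \<omega>) \<and>
      (\<forall>n. (\<integral>\<omega>. (norm (x n \<omega> - y \<omega>))\<^sup>2 \<partial>P) \<le> 4 * \<theta> ^ n * (\<integral>\<omega>. (infdist (x 0 \<omega>) Z)\<^sup>2 \<partial>P))"
    if \<theta>: "0 < \<theta>" "\<theta> < 1" "\<forall>n. AE \<omega> in P.
          real_cond_exp P (history P x n) (\<lambda>\<omega>. (infdist (x (Suc n) \<omega>) Z)\<^sup>2) \<omega>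
            \<le> \<theta> * (infdist (x n \<omega>) Z)\<^sup>2" for \<theta>
  proof -
    have "(\<integral>\<omega>. (infdist (x (Suc n) \<omega>) common_fix)\<^sup>2 \<partial>P)
        \<le> \<theta> * (\<integral>\<omega>. (infdist (x n \<omega>) common_fix)\<^sup>2 \<partial>P)" for n
      using \<theta>(3) unfolding Z by (intro contraction_of_cond_exp) blast
    from linear_convergence[OF this less_imp_le[OF \<theta>(1)] \<theta>(2)] show ?thesis
      unfolding Z by blast
  qed
  have linearly_regular_case: "Lp_converges 2 P x y \<and> (AE \<omega> in P. (\<lambda>n. x n \<omega>) \<longlonglongrightarrow> y \<omega>) \<and>
      (\<forall>n. (\<integral>\<omega>. (norm (x n \<omega> - y \<omega>))\<^sup>2 \<partial>P) \<le> 4 * \<theta> ^ n * (\<integral>\<omega>. (infdist (x 0 \<omega>) Z)\<^sup>2 \<partial>P))"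
    if \<nu>: "1 \<le> \<nu>" "\<forall>y. (infdist y Z)\<^sup>2 \<le> \<nu> * (\<integral>\<omega>. (norm (T (k \<omega>) y - y))\<^sup>2 \<partial>P)"
      and \<theta>: "\<theta> = 1 - \<mu> * \<delta> * (INF j. \<integral>\<omega>. (\<Lambda> j \<omega>)\<^sup>2 \<partial>P) / (\<rho>\<^sup>2 * \<nu>)" for \<nu> \<theta>
  proof -
    \<comment> \<open>The iteration contracts with the factor \<open>\<theta>'\<close>, which is at most \<open>\<theta>\<close> since \<open>E \<lambda>\<^sub>j\<^sup>2 \<le> \<rho>\<^sup>2\<close>; it lies in \<open>[0, 1)\<close>.\<close>
    define \<theta>' where "\<theta>' = 1 - \<mu> * \<delta> / \<nu>"
    have rate: "(\<integral>\<omega>. (infdist (x (Suc n) \<omega>) common_fix)\<^sup>2 \<partial>P)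
        \<le> \<theta>' * (\<integral>\<omega>. (infdist (x n \<omega>) common_fix)\<^sup>2 \<partial>P)" for n
      unfolding \<theta>'_def using \<nu> unfolding Z
      by (intro contraction_of_linear_regularity) (auto simp: residual_def)
    have "\<mu> * \<delta> / \<nu> \<le> 1" "0 < \<mu> * \<delta> / \<nu>"
      using \<nu>(1) \<mu>\<delta> by (auto simp: divide_le_eq)
    then have \<theta>': "0 \<le> \<theta>'" "\<theta>' < 1" by (auto simp: \<theta>'_def)
    have "(INF j. \<integral>\<omega>. (\<Lambda> j \<omega>)\<^sup>2 \<partial>P) \<le> (\<integral>\<omega>. (\<Lambda> 0 \<omega>)\<^sup>2 \<partial>P)"
      by (intro cINF_lower bdd_belowI[of _ 0]) auto
    also have "\<dots> \<le> \<rho>\<^sup>2" using relaxation_bounds(5) \<Lambda>_Linf by blast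
    finally have "(INF j. \<integral>\<omega>. (\<Lambda> j \<omega>)\<^sup>2 \<partial>P) / \<rho>\<^sup>2 \<le> 1"
      using \<rho> by (simp add: divide_le_eq)
    from mult_left_mono[OF this, of "\<mu> * \<delta> / \<nu>"] \<open>0 < \<mu> * \<delta> / \<nu>\<close>
    have "\<theta>' \<le> \<theta>" by (simp add: \<theta> \<theta>'_def mult.commute)
    then have pow: "\<theta>' ^ n \<le> \<theta> ^ n" for n using \<theta>'(1) by (rule power_mono)
    note lin = linear_convergence[OF rate \<theta>']
    have "(\<integral>\<omega>. (norm (x n \<omega> - y \<omega>))\<^sup>2 \<partial>P) \<le> 4 * \<theta> ^ n * (\<integral>\<omega>. (infdist (x 0 \<omega>) Z)\<^sup>2 \<partial>P)" for n
    proof -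
      have "4 * \<theta>' ^ n * (\<integral>\<omega>. (infdist (x 0 \<omega>) Z)\<^sup>2 \<partial>P)
          \<le> 4 * \<theta> ^ n * (\<integral>\<omega>. (infdist (x 0 \<omega>) Z)\<^sup>2 \<partial>P)"
        using pow[of n] by (intro mult_right_mono mult_left_mono) auto
      with lin(1)[of n] show ?thesis unfolding Z by linarith
    qed
    with lin(2,3) show ?thesis by blast
  qed
  show ?thesis
  proof (intro bexI[of _ y] conjI, goal_cases)
    case 1 show ?case by (rule weakly_convergent_in_L2)
  next
    case 2 show ?case by (rule y(3))
  next
    case 3 show ?case
    proof (intro impI, elim bexE conjE)
      fix S assume "S \<in> sets P" "measure P S > 0"
        "S \<subseteq> {\<omega> \<in> space P. \<forall>y\<in>Fix (T (k \<omega>)). demiregular_at (\<lambda>z. T (k \<omega>) z - z) y}"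
      then show "Lp_converges 1 P x y \<and> (AE \<omega> in P. (\<lambda>n. x n \<omega>) \<longlonglongrightarrow> y \<omega>)"
        by (intro demiregular_case)
    qed
  next
    case 4 show ?case
    proof (intro allI impI, elim disjE, goal_cases)
      case (1 \<theta>)
      then show ?case by (elim conjE) (rule cond_exp_case)
    next
      case (2 \<theta>)
      then show ?case by (elim exE conjE) (rule linearly_regular_case)
    qed
  next
    case 5 show ?case by (rule in_Lp)
  qed
qed

end
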